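(* Every finite simple graph $G$ that contains neither $P_6$ nor $C_4$ as an induced subgraph satisfies $\chi(G)\le\frac{3}{2}\omega(G)$.
   Context: $P_6$ is the path on $6$ vertices, $C_4$ the cycle on $4$ vertices; $\chi$ is the chromatic number and $\omega$ the clique number. *)

theory Defs
  imports "Graph_Theory.Graph_Theory"
begin

text \<open>
  Finite simple graphs are represented by the locale \<^locale>\<open>pair_graph\<close>: finitely many vertices,
  and a symmetric irreflexive set of arcs, an undirected edge being a pair of opposite arcs.
  Graphs without vertices are admitted; their chromatic and clique numbers are \<open>0\<close>.
\<close>

definition path_graph :: "nat \<Rightarrow> nat pair_pre_digraph" where
  "path_graph n =
    \<lparr> pverts = {..<n},
      parcs = {(i, j). i < n \<and> j < n \<and> (j = Suc i \<or> i = Suc j)} \<rparr>"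

text \<open>This is the cycle on \<open>n\<close> vertices only for \<open>n \<ge> 3\<close>.\<close>

definition cycle_graph :: "nat \<Rightarrow> nat pair_pre_digraph" where
  "cycle_graph n =
    \<lparr> pverts = {..<n},
      parcs = {(i, j). i < n \<and> j < n \<and> (j = Suc i mod n \<or> i = Suc j mod n)} \<rparr>"

definition contains_induced :: "'a pair_pre_digraph \<Rightarrow> 'b pair_pre_digraph \<Rightarrow> bool" where
  "contains_induced G H \<longleftrightarrow>
    (\<exists>K :: 'a pair_pre_digraph.
      induced_subgraph (with_proj K) (with_proj G) \<and> digraph_iso (with_proj H) (with_proj K))"

definition proper_colouring :: "'a pair_pre_digraph \<Rightarrow> nat \<Rightarrow> ('a \<Rightarrow> nat) \<Rightarrow> bool" where
  "proper_colouring G k c \<longleftrightarrow>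
    c ` pverts G \<subseteq> {..<k} \<and> (\<forall>(u, v) \<in> parcs G. c u \<noteq> c v)"

definition chromatic_number :: "'a pair_pre_digraph \<Rightarrow> nat" where
  "chromatic_number G = (LEAST k. \<exists>c. proper_colouring G k c)"

definition is_clique :: "'a pair_pre_digraph \<Rightarrow> 'a set \<Rightarrow> bool" where
  "is_clique G S \<longleftrightarrow> S \<subseteq> pverts G \<and> pairwise (\<lambda>u v. (u, v) \<in> parcs G) S"

definition clique_number :: "'a pair_pre_digraph \<Rightarrow> nat" where
  "clique_number G = Max {card S | S. is_clique G S}"

lemma pair_graph_path_graph: "pair_graph (path_graph n)"
proof unfold_locales
  show "finite (parcs (path_graph n))"
    by (rule finite_subset[of _ "{..<n} \<times> {..<n}"]) (auto simp: path_graph_def)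
  show "symmetric (with_proj (path_graph n))"
    by (auto simp: symmetric_def path_graph_def intro!: symI)
qed (auto simp: path_graph_def)

lemma pair_graph_cycle_graph:
  assumes "n \<ge> 3" shows "pair_graph (cycle_graph n)"
proof unfold_locales
  show "finite (parcs (cycle_graph n))"
    by (rule finite_subset[of _ "{..<n} \<times> {..<n}"]) (auto simp: cycle_graph_def)
  show "symmetric (with_proj (cycle_graph n))"
    by (auto simp: symmetric_def cycle_graph_def intro!: symI)
  show "fst e \<noteq> snd e" if "e \<in> parcs (cycle_graph n)" for e
  proof -
    have "Suc i mod n \<noteq> i" if "i < n" for i
      using that assms by (cases "Suc i = n") auto
    with that show ?thesis by (fastforce simp: cycle_graph_def)
  qed
qed (auto simp: cycle_graph_def)

lemma parcs_cycle_graph_4: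
  "parcs (cycle_graph 4) = {(0, 1), (1, 2), (2, 3), (3, 0), (1, 0), (2, 1), (3, 2), (0, 3)}"
proof -
  have "i < 4 \<longleftrightarrow> i = 0 \<or> i = 1 \<or> i = 2 \<or> i = 3" for i :: nat by arith
  then have "parcs (cycle_graph 4) = {(i, j). i \<in> {0, 1, 2, 3} \<and> j \<in> {0, 1, 2, 3} \<and>
      (j = Suc i mod 4 \<or> i = Suc j mod 4)}"
    by (simp add: cycle_graph_def)
  also have "\<dots> = {0, 1, 2, 3} \<times> {0, 1, 2, 3} \<inter> {(i, j). j = Suc i mod 4 \<or> i = Suc j mod 4}"
    by blast
  also have "\<dots> = {(0, 1), (1, 2), (2, 3), (3, 0), (1, 0), (2, 1), (3, 2), (0, 3)}"
    by (simp add: Int_insert_left, simp add: insert_commute)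
  finally show ?thesis .
qed

lemma contains_induced_iff_embedding:
  assumes "pair_graph G" "pair_graph H"
  shows "contains_induced G H \<longleftrightarrow>
    (\<exists>f. inj_on f (pverts H) \<and> f ` pverts H \<subseteq> pverts G \<and>
      (\<forall>u \<in> pverts H. \<forall>v \<in> pverts H. (u, v) \<in> parcs H \<longleftrightarrow> (f u, f v) \<in> parcs G))"
    (is "_ \<longleftrightarrow> ?R")
proof
  interpret G: pair_graph G by fact
  interpret H: pair_graph H by fact
  assume "contains_induced G H"
  then obtain K h where K: "induced_subgraph (with_proj K) (with_proj G)"
    and h: "pre_digraph.digraph_isomorphism (with_proj H) h" and eq: "with_proj K = app_iso h (with_proj H)"
    unfolding contains_induced_def digraph_iso_def by blast
  define f where "f = iso_verts h"
  have pv: "pverts K = f ` pverts H" and pa: "parcs K = iso_arcs h ` parcs H"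
    and tl: "iso_tail h = fst" and hd: "iso_head h = snd"
    using arg_cong[OF eq, of verts] arg_cong[OF eq, of arcs] arg_cong[OF eq, of tail]
      arg_cong[OF eq, of head] by (simp_all add: f_def)
  have arc: "iso_arcs h (u, v) = (f u, f v)" if "(u, v) \<in> parcs H" for u v
    using h that by (auto simp: pre_digraph.digraph_isomorphism_def tl hd f_def prod_eq_iff)
  have inj: "inj_on f (pverts H)"
    using h by (simp add: pre_digraph.digraph_isomorphism_def f_def)
  have sub: "pverts K \<subseteq> pverts G"
    and ind: "parcs K = {e \<in> parcs G. fst e \<in> pverts K \<and> snd e \<in> pverts K}"
    using K by (simp_all add: induced_subgraph_def subgraph_def)
  have "(u, v) \<in> parcs H \<longleftrightarrow> (f u, f v) \<in> parcs G"
    if uv: "u \<in> pverts H" "v \<in> pverts H" for u v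
  proof
    assume "(u, v) \<in> parcs H"
    then have "(f u, f v) \<in> parcs K"
      using imageI[of "(u, v)" "parcs H" "iso_arcs h"] by (simp add: pa arc)
    then show "(f u, f v) \<in> parcs G" using ind by auto
  next
    assume "(f u, f v) \<in> parcs G"
    then have "(f u, f v) \<in> parcs K" using ind uv pv by auto
    then obtain e where "e \<in> parcs H" "(f u, f v) = iso_arcs h e"
      unfolding pa by (elim imageE)
    then obtain x y where xy: "(x, y) \<in> parcs H" and "f u = f x" "f v = f y"
      using arc by (cases e) simp
    then have "u = x" "v = y"
      using inj uv H.in_arcsD1[OF xy] H.in_arcsD2[OF xy] by (simp_all add: inj_on_eq_iff)
    with xy show "(u, v) \<in> parcs H" by simp
  qed
  with inj sub pv show ?R by blast
next
  interpret G: pair_graph G by fact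
  interpret H: pair_graph H by fact
  assume ?R
  then obtain f where inj: "inj_on f (pverts H)" and sub: "f ` pverts H \<subseteq> pverts G"
    and adj: "\<And>u v. u \<in> pverts H \<Longrightarrow> v \<in> pverts H \<Longrightarrow> (u, v) \<in> parcs H \<longleftrightarrow> (f u, f v) \<in> parcs G"
    by blast
  define K where "K = \<lparr> pverts = f ` pverts H, parcs = map_prod f f ` parcs H \<rparr>"
  define h where "h = \<lparr> iso_verts = f, iso_arcs = map_prod f f, iso_head = snd, iso_tail = fst \<rparr>"
  have "inj_on (map_prod f f) (parcs H)"
    by (rule inj_on_subset[OF map_prod_inj_on[OF inj inj]]) (auto dest: H.in_arcsD1 H.in_arcsD2)
  then have iso: "pre_digraph.digraph_isomorphism (with_proj H) h"
    using inj H.wf_digraph by (simp add: pre_digraph.digraph_isomorphism_def h_def)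
  have eq: "with_proj K = app_iso h (with_proj H)"
    by (simp add: app_iso_def with_proj_def K_def h_def)
  have ind: "parcs K = {e \<in> parcs G. fst e \<in> pverts K \<and> snd e \<in> pverts K}"
  proof (intro equalityI subsetI)
    fix e assume "e \<in> parcs K"
    then obtain u v where "(u, v) \<in> parcs H" "e = (f u, f v)" by (auto simp: K_def)
    then show "e \<in> {e \<in> parcs G. fst e \<in> pverts K \<and> snd e \<in> pverts K}"
      using adj[of u v] H.in_arcsD1 H.in_arcsD2 by (auto simp: K_def)
  next
    fix e assume "e \<in> {e \<in> parcs G. fst e \<in> pverts K \<and> snd e \<in> pverts K}"
    then obtain u v where uv: "u \<in> pverts H" "v \<in> pverts H" "e = (f u, f v)" "e \<in> parcs G"
      by (cases e) (auto simp: K_def)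
    then have "(u, v) \<in> parcs H" using adj[of u v] by simp
    then show "e \<in> parcs K" using uv(3) by (force simp: K_def)
  qed
  have "wf_digraph (with_proj K)"
    by unfold_locales (auto simp: K_def dest: H.in_arcsD1 H.in_arcsD2)
  moreover have "pverts K \<subseteq> pverts G" using sub by (simp add: K_def)
  moreover have "parcs K \<subseteq> parcs G" using ind by auto
  ultimately have "induced_subgraph (with_proj K) (with_proj G)"
    using ind G.wf_digraph by (simp add: induced_subgraph_def subgraph_def compatible_def)
  then show "contains_induced G H"
    unfolding contains_induced_def digraph_iso_def using iso eq by blast
qed

lemma proper_colouring_chromatic_number:
  assumes "pair_graph G"
  shows "\<exists>c. proper_colouring G (chromatic_number G) c"
proof -
  interpret pair_graph G by fact
  obtain c :: "_ \<Rightarrow> nat" and n where c: "c ` pverts G = {i. i < n}" "inj_on c (pverts G)"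
    using finite_imp_inj_to_nat_seg[OF pair_finite_verts] by metis
  have "c u \<noteq> c v" if "(u, v) \<in> parcs G" for u v
    using c(2) that in_arcsD1 in_arcsD2 pair_no_loops by (fastforce dest: inj_onD)
  with c(1) have "proper_colouring G n c" by (auto simp: proper_colouring_def)
  then show ?thesis
    unfolding chromatic_number_def
    by (intro LeastI[where P = "\<lambda>k. \<exists>c. proper_colouring G k c"] exI[of _ c])
qed

lemma
  assumes "pair_graph G"
  shows clique_number_attained: "\<exists>S. is_clique G S \<and> card S = clique_number G"
    and card_clique_le: "is_clique G S \<Longrightarrow> card S \<le> clique_number G"
proof -
  interpret pair_graph G by fact
  have fin: "finite {card S | S. is_clique G S}"
    by (rule finite_subset[of _ "card ` Pow (pverts G)"])
      (auto simp: is_clique_def pair_finite_verts)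
  have "is_clique G {}" by (simp add: is_clique_def)
  then have "{card S | S. is_clique G S} \<noteq> {}" by blast
  from Max_in[OF fin this] show "\<exists>S. is_clique G S \<and> card S = clique_number G"
    unfolding clique_number_def by auto
  show "is_clique G S \<Longrightarrow> card S \<le> clique_number G"
    unfolding clique_number_def by (rule Max_ge[OF fin]) blast
qed

end

theory Submission
  imports Defs
begin

text \<open>
  A minimal counterexample \<open>G\<close> with clique number \<open>w\<close> has no clique cutset, no universal vertex and no
  vertex whose closed neighbourhood has at most \<open>3 w / 2\<close> elements, and it is not a blow-up of a
  \<open>3\<close>-colourable graph. Having no clique cutset it contains a \<open>5\<close>-hole or a \<open>6\<close>-hole, and each
  \<open>5\<close>-hole is dominating. The kinds of holes are then excluded one after the other. Around a
  \<open>6\<close>-hole with a vertex seeing two opposite or four consecutive vertices of it, \<open>G\<close> is either a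
  blow-up of the Petersen graph or of a graph on nine vertices, both \<open>3\<close>-colourable, or there are two
  vertices whose closed neighbourhoods are covered, with multiplicity, by three cliques, so that one
  of them has at most \<open>3 w / 2\<close> elements. Covers by three cliques also settle the other \<open>6\<close>-holes
  and, once there are no \<open>6\<close>-holes, the pyramids. Finally, around a \<open>5\<close>-hole of maximum
  degree sum \<open>G\<close> is a ring of five cliques, and a vertex of minimum degree in a suitable one of
  them has a small neighbourhood.
\<close>

section \<open>Colourings of sets of vertices\<close>

text \<open>The ratio \<open>3/2\<close> enters in two ways. Deleting a 3-colourable set costs three
  colours, and if this lowers the clique number by two, the bound \<open>3 * w div 2\<close> is met
  exactly. Moreover, a vertex with a small closed neighbourhood can be coloured last; here two
  vertices are treated at once, because three cliques have at most \<open>3 * w\<close> elements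
  altogether. If they cover both neighbourhoods, and the common part twice, one neighbourhood is
  small. The obstacle is that vertices with the same neighbours on a hole may differ in their other
  neighbours, so that sets expected to be cliques need not be complete to each other. Where this
  matters, an extremal choice by degree is combined with an exchange argument: a vertex that gains a
  neighbour over its competitor must also lose one, and the two witnesses create a forbidden
  configuration. That a hole exists at all comes from the nonneighbours of a vertex
  \<open>x\<close>: two nonadjacent attachments of a component of these are joined by a shortest
  path through the component, which \<open>x\<close> closes to a hole. Excluding \<open>P6\<close>
  keeps its length at most six.\<close>

definition clq :: "('a \<Rightarrow> 'a \<Rightarrow> bool) \<Rightarrow> 'a set \<Rightarrow> bool" where
  "clq A K \<longleftrightarrow> (\<forall>x \<in> K. \<forall>y \<in> K. A x y)"

definition clique_bound :: "('a \<Rightarrow> 'a \<Rightarrow> bool) \<Rightarrow> 'a set \<Rightarrow> nat \<Rightarrow> bool" where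
  "clique_bound A W m \<longleftrightarrow> (\<forall>K \<subseteq> W. clq A K \<longrightarrow> card K \<le> m)"

definition colourable :: "('a \<Rightarrow> 'a \<Rightarrow> bool) \<Rightarrow> 'a set \<Rightarrow> nat \<Rightarrow> bool" where
  "colourable A W k \<longleftrightarrow> (\<exists>c :: 'a \<Rightarrow> nat. (\<forall>x \<in> W. c x < k) \<and>
    (\<forall>x \<in> W. \<forall>y \<in> W. x \<noteq> y \<longrightarrow> A x y \<longrightarrow> c x \<noteq> c y))"

lemma colourable_mono: "colourable A W k \<Longrightarrow> k \<le> l \<Longrightarrow> colourable A W l"
  unfolding colourable_def using order_less_le_trans by blast

lemma clique_bound_subset: "clique_bound A W m \<Longrightarrow> W' \<subseteq> W \<Longrightarrow> clique_bound A W' m"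
  unfolding clique_bound_def by blast

lemma colourable_Un:
  assumes "colourable A W k" "colourable A U l"
  shows "colourable A (W \<union> U) (k + l)"
proof -
  obtain c where c: "\<forall>x \<in> W. c x < k" "\<forall>x \<in> W. \<forall>y \<in> W. x \<noteq> y \<longrightarrow> A x y \<longrightarrow> c x \<noteq> c y"
    using assms(1) unfolding colourable_def by blast
  obtain d where d: "\<forall>x \<in> U. d x < l" "\<forall>x \<in> U. \<forall>y \<in> U. x \<noteq> y \<longrightarrow> A x y \<longrightarrow> d x \<noteq> d y"
    using assms(2) unfolding colourable_def by blast
  define e where "e x = (if x \<in> W then c x else k + d x)" for x
  have "e x < k + l" if "x \<in> W \<union> U" for x
  proof (cases "x \<in> W")
    case True
    then have "c x < k" using c(1) by blast
    then show ?thesis using True by (simp add: e_def)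
  next
    case False
    then have "d x < l" using d(1) that by blast
    then show ?thesis using False by (simp add: e_def)
  qed
  moreover have "e x \<noteq> e y" if "x \<in> W \<union> U" "y \<in> W \<union> U" "x \<noteq> y" "A x y" for x y
  proof -
    have "x \<in> W \<Longrightarrow> c x < k" "y \<in> W \<Longrightarrow> c y < k" using c(1) by blast+
    moreover have "x \<in> W \<Longrightarrow> y \<in> W \<Longrightarrow> c x \<noteq> c y" using c(2) that by blast
    moreover have "x \<notin> W \<Longrightarrow> y \<notin> W \<Longrightarrow> d x \<noteq> d y" using d(2) that by blast
    ultimately show ?thesis by (auto simp: e_def)
  qed
  ultimately show ?thesis unfolding colourable_def by blast
qed

lemma colourable_singleton: "colourable A {v} 1"
  unfolding colourable_def by (rule exI[of _ "\<lambda>_. 0"]) auto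

lemma colourable_insert:
  assumes "finite W" "v \<notin> W" "\<And>x y. A x y = A y x"
    and "colourable A W k" "card {y \<in> W. A v y} < k"
  shows "colourable A (insert v W) k"
proof -
  obtain c where c: "\<forall>x \<in> W. c x < k" "\<forall>x \<in> W. \<forall>y \<in> W. x \<noteq> y \<longrightarrow> A x y \<longrightarrow> c x \<noteq> c y"
    using assms(4) unfolding colourable_def by blast
  have "card (c ` {y \<in> W. A v y}) < card {..<k}"
    using card_image_le[of "{y \<in> W. A v y}" c] assms(1,5) by simp
  then obtain i where i: "i < k" "i \<notin> c ` {y \<in> W. A v y}"
    using card_mono[of "c ` {y \<in> W. A v y}" "{..<k}"] assms(1) by fastforce
  have "(c(v := i)) x \<noteq> (c(v := i)) y"
    if "x \<in> insert v W" "y \<in> insert v W" "x \<noteq> y" "A x y" for x y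
  proof -
    have "c z \<noteq> i" if "z \<in> W" "A v z" for z using i(2) that by blast
    moreover have "x \<in> W \<Longrightarrow> y \<in> W \<Longrightarrow> c x \<noteq> c y" using c(2) that by blast
    ultimately show ?thesis using that assms(3)[of x y] by (cases "x = v"; cases "y = v") auto
  qed
  moreover have "(c(v := i)) x < k" if "x \<in> insert v W" for x
    using that i(1) c(1) by auto
  ultimately show ?thesis unfolding colourable_def by blast
qed

text \<open>The colours on a clique are pairwise distinct, so renaming the colours of one side makes
  both colourings agree on \<open>K\<close>; no edge joins \<open>X\<close> to
  \<open>Y\<close>.\<close>

lemma colourable_glue:
  assumes "colourable A (X \<union> K) k" "colourable A (Y \<union> K) k" "clq A K" "finite K"
    and "X \<inter> K = {}" "Y \<inter> K = {}" "X \<inter> Y = {}"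
    and "\<And>x y. A x y = A y x" "\<And>x y. x \<in> X \<Longrightarrow> y \<in> Y \<Longrightarrow> \<not> A x y"
  shows "colourable A (X \<union> Y \<union> K) k"
proof -
  obtain c where c: "\<forall>x \<in> X \<union> K. c x < k"
      "\<forall>x \<in> X \<union> K. \<forall>y \<in> X \<union> K. x \<noteq> y \<longrightarrow> A x y \<longrightarrow> c x \<noteq> c y"
    using assms(1) unfolding colourable_def by blast
  obtain d where d: "\<forall>x \<in> Y \<union> K. d x < k"
      "\<forall>x \<in> Y \<union> K. \<forall>y \<in> Y \<union> K. x \<noteq> y \<longrightarrow> A x y \<longrightarrow> d x \<noteq> d y"
    using assms(2) unfolding colourable_def by blast
  have ic: "inj_on c K" and id: "inj_on d K"
    using c(2) d(2) assms(3) unfolding inj_on_def clq_def by blast+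
  define g where "g = c \<circ> inv_into K d"
  have g: "bij_betw g (d ` K) (c ` K)"
    unfolding g_def using ic id by (intro bij_betw_trans[of _ _ K] bij_betw_inv_into) (auto simp: bij_betw_def)
  have sub: "c ` K \<subseteq> {..<k}" "d ` K \<subseteq> {..<k}" using c(1) d(1) by auto
  have "card ({..<k} - d ` K) = card ({..<k} - c ` K)"
    using sub ic id assms(4) by (simp add: card_Diff_subset card_image)
  then obtain h where h: "bij_betw h ({..<k} - d ` K) ({..<k} - c ` K)"
    using finite_same_card_bij by blast
  define p where "p i = (if i \<in> d ` K then g i else h i)" for i
  have "bij_betw p (d ` K) (c ` K)"
    using bij_betw_cong[of "d ` K" p g] g by (simp add: p_def)
  moreover have "bij_betw p ({..<k} - d ` K) ({..<k} - c ` K)"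
    using bij_betw_cong[of "{..<k} - d ` K" p h] h by (simp add: p_def)
  ultimately have "bij_betw p (d ` K \<union> ({..<k} - d ` K)) (c ` K \<union> ({..<k} - c ` K))"
    by (rule bij_betw_combine) blast
  then have p: "bij_betw p {..<k} {..<k}" using sub by (simp add: Un_absorb1)
  have pd: "p (d x) = c x" if "x \<in> K" for x
    using that id by (simp add: p_def g_def)
  define e where "e x = (if x \<in> X \<union> K then c x else p (d x))" for x
  have eY: "e x = p (d x)" if "x \<in> Y \<union> K" for x
    using that assms(5-7) pd by (auto simp: e_def)
  have eX: "e x = c x" if "x \<in> X \<union> K" for x
    using that by (simp add: e_def)
  have "e x < k" if "x \<in> X \<union> Y \<union> K" for x
  proof (cases "x \<in> X \<union> K")
    case False
    then have "d x < k" using that d(1) by blast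
    then show ?thesis using False bij_betwE[OF p] by (simp add: e_def)
  qed (use c(1) eX in auto)
  moreover have "e x \<noteq> e y"
    if xy: "x \<in> X \<union> Y \<union> K" "y \<in> X \<union> Y \<union> K" "x \<noteq> y" "A x y" for x y
  proof -
    consider "x \<in> X \<union> K" "y \<in> X \<union> K" | "x \<in> Y \<union> K" "y \<in> Y \<union> K"
      using xy assms(8,9) by blast
    then show ?thesis
    proof cases
      case 1
      then have "c x \<noteq> c y" using c(2) xy by blast
      then show ?thesis using 1 eX by simp
    next
      case 2
      then have "d x \<noteq> d y" "d x < k" "d y < k" using d xy by blast+
      then have "p (d x) \<noteq> p (d y)" using bij_betw_imp_inj_on[OF p] by (auto simp: inj_on_def)
      then show ?thesis using 2 eY by simp
    qed
  qed
  ultimately show ?thesis unfolding colourable_def by blast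
qed

section \<open>Forbidden configurations\<close>

text \<open>
  Adjacency is closed: \<open>A x y\<close> holds if \<open>x = y\<close>. None of the configurations below contains
  two adjacent vertices with the same closed neighbourhood, so their vertices are automatically
  distinct.
\<close>

locale closed_adjacency =
  fixes V :: "'a set" and A :: "'a \<Rightarrow> 'a \<Rightarrow> bool"
  assumes fin: "finite V"
    and refl: "A x x"
    and sym: "A x y = A y x"
    and in_V: "A x y \<Longrightarrow> x \<noteq> y \<Longrightarrow> x \<in> V"
begin

text \<open>Lists are used so that rewriting unfolds an instance into a finite conjunction of
  adjacencies, which a propositional solver can handle.\<close>

definition sees :: "'a \<Rightarrow> 'a list \<Rightarrow> bool" where
  "sees x vs \<longleftrightarrow> list_all (A x) vs"

definition misses :: "'a \<Rightarrow> 'a list \<Rightarrow> bool" where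
  "misses x vs \<longleftrightarrow> list_all (\<lambda>v. \<not> A x v) vs"

text \<open>Adjacency being reflexive, a twin of a member \<open>u\<close> of \<open>us\<close> is
  itself adjacent to \<open>u\<close> or equal to it: it belongs to the bag of \<open>u\<close> in a
  blow-up.\<close>

definition twin :: "'a \<Rightarrow> 'a \<Rightarrow> 'a list \<Rightarrow> bool" where
  "twin y u us \<longleftrightarrow> list_all (\<lambda>b. A y b = A u b) us"

definition twinned :: "'a \<Rightarrow> 'a list \<Rightarrow> bool" where
  "twinned y us \<longleftrightarrow> list_ex (\<lambda>u. twin y u us) us"

definition nb :: "'a \<Rightarrow> 'a set" where
  "nb x = {y \<in> V. A x y}"

definition path6 :: "'a \<Rightarrow> 'a \<Rightarrow> 'a \<Rightarrow> 'a \<Rightarrow> 'a \<Rightarrow> 'a \<Rightarrow> bool" where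
  "path6 a b c d e f \<longleftrightarrow> sees a [b] \<and> misses a [c, d, e, f] \<and> sees b [c] \<and> misses b [d, e, f] \<and>
    sees c [d] \<and> misses c [e, f] \<and> sees d [e] \<and> misses d [f] \<and> sees e [f]"

definition hole4 :: "'a \<Rightarrow> 'a \<Rightarrow> 'a \<Rightarrow> 'a \<Rightarrow> bool" where
  "hole4 a b c d \<longleftrightarrow> sees a [b, d] \<and> misses a [c] \<and> sees b [c] \<and> misses b [d] \<and> sees c [d]"

definition hole5 :: "'a \<Rightarrow> 'a \<Rightarrow> 'a \<Rightarrow> 'a \<Rightarrow> 'a \<Rightarrow> bool" where
  "hole5 a b c d e \<longleftrightarrow> sees a [b, e] \<and> misses a [c, d] \<and> sees b [c] \<and> misses b [d, e] \<and>
    sees c [d] \<and> misses c [e] \<and> sees d [e]"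

definition hole6 :: "'a \<Rightarrow> 'a \<Rightarrow> 'a \<Rightarrow> 'a \<Rightarrow> 'a \<Rightarrow> 'a \<Rightarrow> bool" where
  "hole6 a b c d e f \<longleftrightarrow> sees a [b, f] \<and> misses a [c, d, e] \<and> sees b [c] \<and> misses b [d, e, f] \<and>
    sees c [d] \<and> misses c [e, f] \<and> sees d [e] \<and> misses d [f] \<and> sees e [f]"

definition hole6_pair :: "'a \<Rightarrow> 'a \<Rightarrow> 'a \<Rightarrow> 'a \<Rightarrow> 'a \<Rightarrow> 'a \<Rightarrow> 'a \<Rightarrow> bool" where
  "hole6_pair a b c d e f g \<longleftrightarrow> hole6 a b c d e f \<and> sees g [a, d] \<and> misses g [b, c, e, f]"

definition hole6_quad :: "'a \<Rightarrow> 'a \<Rightarrow> 'a \<Rightarrow> 'a \<Rightarrow> 'a \<Rightarrow> 'a \<Rightarrow> 'a \<Rightarrow> bool" where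
  "hole6_quad a b c d e f g \<longleftrightarrow> hole6 a b c d e f \<and> sees g [a, b, c, d] \<and> misses g [e, f]"

text \<open>Apex \<open>x\<close>, base triangle \<open>a b c\<close>, and three legs of length two
  through \<open>p\<close>, \<open>q\<close> and \<open>r\<close>.\<close>

definition pyramid :: "'a \<Rightarrow> 'a \<Rightarrow> 'a \<Rightarrow> 'a \<Rightarrow> 'a \<Rightarrow> 'a \<Rightarrow> 'a \<Rightarrow> bool" where
  "pyramid x p q r a b c \<longleftrightarrow> sees x [p, q, r] \<and> misses x [a, b, c] \<and>
    sees p [a] \<and> misses p [q, r, b, c] \<and> sees q [b] \<and> misses q [r, a, c] \<and>
    sees r [c] \<and> misses r [a, b] \<and> sees a [b, c] \<and> sees b [c]"

text \<open>The Petersen graph: \<open>r\<close>, \<open>s\<close> and \<open>t\<close> complete the first seven vertices.\<close>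

definition petersen ::
    "'a \<Rightarrow> 'a \<Rightarrow> 'a \<Rightarrow> 'a \<Rightarrow> 'a \<Rightarrow> 'a \<Rightarrow> 'a \<Rightarrow> 'a \<Rightarrow> 'a \<Rightarrow> 'a \<Rightarrow> bool" where
  "petersen a b c d e f g r s t \<longleftrightarrow> hole6_pair a b c d e f g \<and>
    sees s [b, e] \<and> misses s [a, c, d, f] \<and> sees t [c, f] \<and> misses t [a, b, d, e] \<and>
    sees r [g, s, t] \<and> misses r [a, b, c, d, e, f] \<and> misses s [g, t] \<and> misses t [g]"

text \<open>Rotating the \<open>6\<close>-hole by two steps permutes \<open>g\<close>, \<open>h\<close> and \<open>i\<close> cyclically.\<close>

definition quad3 :: "'a \<Rightarrow> 'a \<Rightarrow> 'a \<Rightarrow> 'a \<Rightarrow> 'a \<Rightarrow> 'a \<Rightarrow> 'a \<Rightarrow> 'a \<Rightarrow> 'a \<Rightarrow> bool" where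
  "quad3 a b c d e f g h i \<longleftrightarrow> hole6_quad a b c d e f g \<and>
    sees h [c, d, e, f] \<and> misses h [a, b, g] \<and> sees i [a, b, e, f] \<and> misses i [c, d, g] \<and>
    \<not> A h i"

lemmas configuration_defs = sees_def misses_def path6_def hole4_def hole5_def hole6_def
  hole6_pair_def hole6_quad_def pyramid_def petersen_def quad3_def twin_def twinned_def
  list.pred_inject list_ex_Nil_iff list_ex_Cons_iff

text \<open>
  With these rules, a statement about the adjacencies between finitely many named vertices becomes
  a propositional consequence of suitable instances of the forbidden configurations.
\<close>

lemmas finite_simps = configuration_defs simp_thms refl sym

lemma in_V2:
  assumes "A x y" "A x z" "\<not> A y z" shows "x \<in> V \<and> y \<in> V"
proof -
  have "x \<noteq> y" using assms by blast
  then show ?thesis using in_V[of x y] in_V[of y x] assms(1) sym[of x y] by simp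
qed

lemma nb_subset: "nb x \<subseteq> V"
  by (auto simp: nb_def)

lemma finite_nb: "finite (nb x)"
  using fin by (simp add: nb_def)

text \<open>The counting half of every exchange argument: were \<open>nb v\<close> contained in
  \<open>nb u\<close>, then \<open>z\<close> would make the inclusion proper, against the
  cardinalities.\<close>

lemma nb_exchange:
  assumes "card (nb u) \<le> card (nb v)" "z \<in> V" "A z u" "\<not> A z v"
  shows "\<exists>y \<in> V. A y v \<and> \<not> A y u"
proof (rule ccontr)
  assume "\<not> ?thesis"
  then have "nb v \<subset> nb u" using assms sym unfolding nb_def by blast
  then show False using assms(1) psubset_card_mono[OF finite_nb] by (meson leD)
qed

section \<open>Components and shortest paths through them\<close>

definition component :: "'a set \<Rightarrow> 'a \<Rightarrow> 'a set" where
  "component X x = {y. (\<lambda>a b. A a b \<and> a \<in> X \<and> b \<in> X)\<^sup>*\<^sup>* x y}"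

lemma component_self: "x \<in> component X x"
  by (simp add: component_def)

lemma component_subset:
  assumes "x \<in> X" shows "component X x \<subseteq> X"
proof
  fix y assume "y \<in> component X x"
  then have "(\<lambda>a b. A a b \<and> a \<in> X \<and> b \<in> X)\<^sup>*\<^sup>* x y" by (simp add: component_def)
  then show "y \<in> X" by (induction) (use assms in auto)
qed

lemma component_closed:
  assumes "x \<in> X" "y \<in> component X x" "A y z" "z \<in> X"
  shows "z \<in> component X x"
  using assms component_subset[OF assms(1)] unfolding component_def
  by (auto intro: rtranclp.rtrancl_into_rtrancl)

lemma component_walk:
  assumes "x \<in> X" "k \<in> component X x" "k' \<in> component X x"
  shows "\<exists>f n. f 0 = k \<and> f n = k' \<and> (\<forall>i<n. A (f i) (f (Suc i))) \<and> (\<forall>i\<le>n. f i \<in> component X x)"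
proof -
  let ?R = "\<lambda>a b. A a b \<and> a \<in> X \<and> b \<in> X"
  have flip: "?R\<^sup>*\<^sup>* b a" if "?R\<^sup>*\<^sup>* a b" for a b
    using that
  proof (induction rule: rtranclp_induct)
    case (step y z)
    then have "?R z y" by (simp add: sym)
    then show ?case using step(3) by (rule converse_rtranclp_into_rtranclp)
  qed simp
  have "?R\<^sup>*\<^sup>* x k" "?R\<^sup>*\<^sup>* x k'" using assms(2,3) by (simp_all add: component_def)
  then have "?R\<^sup>*\<^sup>* k k'" by (rule rtranclp_trans[OF flip])
  then have "\<exists>f n. f 0 = k \<and> f n = k' \<and> (\<forall>i<n. A (f i) (f (Suc i))) \<and>
    (\<forall>i\<le>n. f i \<in> component X x)"
  proof (induction rule: rtranclp_induct)
    case base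
    show ?case using assms(2) by (intro exI[of _ "\<lambda>_. k"] exI[of _ 0]) auto
  next
    case (step y z)
    then obtain f n where f: "f 0 = k" "f n = y" "\<forall>i<n. A (f i) (f (Suc i))"
      "\<forall>i\<le>n. f i \<in> component X x" by blast
    have "z \<in> component X x"
      using component_closed[OF assms(1)] f(2,4) step(2) by blast
    moreover have "\<forall>i<Suc n. A ((f(Suc n := z)) i) ((f(Suc n := z)) (Suc i))"
      using f(2,3) step(2) by (simp add: less_Suc_eq)
    ultimately show ?case
      using f(1,4) by (intro exI[of _ "f(Suc n := z)"] exI[of _ "Suc n"]) (simp add: le_Suc_eq)
  qed
  then show ?thesis .
qed

end

locale P6_C4_free = closed_adjacency +
  assumes no_path6: "\<not> path6 a b c d e f"
    and no_hole4: "\<not> hole4 a b c d"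
begin

text \<open>A shortest walk from \<open>u\<close> to \<open>w\<close> through the component is an
  induced path, and since \<open>P6\<close> is excluded it has at most three inner vertices. Clique
  cutsets are obtained from this: two nonadjacent attachments of a component leave only three cases
  to refute.\<close>

lemma connecting_path:
  assumes "x \<in> X" "k \<in> component X x" "k' \<in> component X x" "A u k" "A k' w" "\<not> A u w"
  obtains (one) a where "a \<in> component X x" "A u a" "A a w"
  | (two) a b where "a \<in> component X x" "b \<in> component X x"
      "sees u [a]" "misses u [b, w]" "sees a [b]" "misses a [w]" "sees b [w]"
  | (three) a b c where "a \<in> component X x" "b \<in> component X x" "c \<in> component X x"
      "sees u [a]" "misses u [b, c, w]" "sees a [b]" "misses a [c, w]" "sees b [c]" "misses b [w]"
      "sees c [w]"
proof -
  let ?K = "component X x"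
  define W where "W f m \<longleftrightarrow> f 0 = u \<and> f m = w \<and> (\<forall>i<m. A (f i) (f (Suc i))) \<and>
    (\<forall>i. 0 < i \<and> i < m \<longrightarrow> f i \<in> ?K)" for f :: "nat \<Rightarrow> 'a" and m
  obtain g n where g: "g 0 = k" "g n = k'" "\<forall>i<n. A (g i) (g (Suc i))" "\<forall>i\<le>n. g i \<in> ?K"
    using component_walk[OF assms(1-3)] by blast
  define h where "h i = (case i of 0 \<Rightarrow> u | Suc j \<Rightarrow> if j \<le> n then g j else w)" for i
  have "W h (Suc (Suc n))"
    unfolding W_def
  proof (intro conjI allI impI)
    fix i assume "i < Suc (Suc n)"
    then consider "i = 0" | j where "i = Suc j" "j < n" | "i = Suc n"
      by (cases i) (auto simp: less_Suc_eq)
    then show "A (h i) (h (Suc i))"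
      by cases (use g assms(4,5) in \<open>simp_all add: h_def\<close>)
  next
    fix i assume "0 < i \<and> i < Suc (Suc n)"
    then obtain j where "i = Suc j" "j \<le> n" by (cases i) auto
    then show "h i \<in> ?K" using g(4) by (simp add: h_def)
  qed (simp_all add: h_def)
  then have ex: "\<exists>m f. W f m" by blast
  define m where "m = (LEAST m. \<exists>f. W f m)"
  obtain f where f: "W f m" using LeastI_ex[OF ex] unfolding m_def by blast
  have le: "m \<le> l" if "W e l" for e l
    unfolding m_def using that by (blast intro: Least_le)
  have ends: "f 0 = u" "f m = w" and edge: "\<And>i. i < m \<Longrightarrow> A (f i) (f (Suc i))"
    and int: "\<And>i. 0 < i \<Longrightarrow> i < m \<Longrightarrow> f i \<in> ?K"
    using f by (auto simp: W_def)
  have chord: "\<not> A (f i) (f j)" if "Suc i < j" "j \<le> m" for i j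
  proof
    assume a: "A (f i) (f j)"
    \<comment> \<open>Skipping the positions strictly between \<open>i\<close> and \<open>j\<close>
      yields a shorter walk. As \<open>A\<close> is reflexive, this also excludes repeated
      vertices.\<close>
    define e where "e l = (if l \<le> i then f l else f (l + (j - i - 1)))" for l
    have "W e (m - (j - i - 1))"
      unfolding W_def
    proof (intro conjI allI impI)
      fix l assume l: "l < m - (j - i - 1)"
      have "l < i \<or> l = i \<or> i < l" by arith
      then show "A (e l) (e (Suc l))"
      proof (elim disjE)
        assume "l = i"
        then show ?thesis using a that by (simp add: e_def)
      qed (use l that edge[of l] edge[of "l + (j - i - 1)"] in \<open>auto simp: e_def\<close>)
    next
      fix l assume "0 < l \<and> l < m - (j - i - 1)"
      then show "e l \<in> ?K"
        using that int[of l] int[of "l + (j - i - 1)"] by (auto simp: e_def)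
    qed (use that ends in \<open>auto simp: e_def\<close>)
    then show False using le that by fastforce
  qed
  have "m \<noteq> 0" using ends assms(6) refl by metis
  moreover have "m \<noteq> 1" using ends edge[of 0] assms(6) by auto
  ultimately consider "m = 2" | "m = 3" | "m = 4" | "m \<ge> 5" by arith
  then show thesis
  proof cases
    case 1
    then show ?thesis using one[of "f 1"] ends int[of 1] edge[of 0] edge[of 1]
      by (simp add: numeral_eq_Suc)
  next
    case 2
    then show ?thesis
      using two[of "f 1" "f 2"] ends int[of 1] int[of 2] edge[of 0] edge[of 1] edge[of 2]
        chord[of 0 2] chord[of 0 3] chord[of 1 3]
      by (simp add: numeral_eq_Suc sees_def misses_def)
  next
    case 3
    then show ?thesis
      using three[of "f 1" "f 2" "f 3"] ends int[of 1] int[of 2] int[of 3]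
        edge[of 0] edge[of 1] edge[of 2] edge[of 3]
        chord[of 0 2] chord[of 0 3] chord[of 0 4] chord[of 1 3] chord[of 1 4] chord[of 2 4]
      by (simp add: numeral_eq_Suc sees_def misses_def)
  next
    case 4
    \<comment> \<open>The first six vertices of an induced path with five or more edges.\<close>
    then have "path6 (f 0) (f 1) (f 2) (f 3) (f 4) (f 5)"
      using edge[of 0] edge[of 1] edge[of 2] edge[of 3] edge[of 4]
        chord[of 0 2] chord[of 0 3] chord[of 0 4] chord[of 0 5] chord[of 1 3] chord[of 1 4]
        chord[of 1 5] chord[of 2 4] chord[of 2 5] chord[of 3 5]
      by (simp add: numeral_eq_Suc path6_def sees_def misses_def)
    then show ?thesis using no_path6 by blast
  qed
qed

section \<open>Components that miss a 5-hole\<close>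

lemma hole5_in_V: "hole5 a b c d e \<Longrightarrow> {a, b, c, d, e} \<subseteq> V"
  using in_V2[of a b e] in_V2[of c b d] in_V2[of d c e] in_V2[of e a d] by (simp only: finite_simps) simp

lemma hole6_in_V: "hole6 a b c d e f \<Longrightarrow> {a, b, c, d, e, f} \<subseteq> V"
  using in_V2[of a b f] in_V2[of c b d] in_V2[of e d f] in_V2[of f a e]
  by (simp only: finite_simps) simp

text \<open>This lemma and the next two treat nonadjacent \<open>u\<close> and \<open>v\<close>,
  each with a neighbour on the hole, joined by a path of one, two or three vertices that miss the
  hole. The path, entered from a suitable stretch of the hole, contains \<open>P6\<close>, or
  \<open>u\<close> and \<open>v\<close> close a \<open>C4\<close>. Symmetry acts as an ordered
  rewrite rule, so each unordered pair is a single propositional atom.\<close>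

lemma undominated_path1:
  assumes "hole5 v1 v2 v3 v4 v5" "misses a [v1, v2, v3, v4, v5]"
    "\<not> misses u [v1, v2, v3, v4, v5]" "\<not> misses v [v1, v2, v3, v4, v5]" "A u a" "A a v"
    "\<not> A u v"
  shows "False"
  using assms no_hole4[of a v v3 u] no_hole4[of u a v v5] no_hole4[of u v1 v a]
    no_hole4[of v v2 u a] no_hole4[of v2 v1 v5 u] no_hole4[of v3 v4 v v2] no_hole4[of v4 v a u]
    no_hole4[of v4 v3 v2 u] no_hole4[of v4 v5 v1 v] no_hole4[of v5 v v2 v1]
    no_hole4[of v5 v4 u v1] no_path6[of a u v2 v3 v4 v5] no_path6[of a u v3 v4 v5 v1]
    no_path6[of a u v5 v1 v2 v3] no_path6[of a v v1 v2 v3 v4] no_path6[of a v v4 v5 v1 v2]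
    no_path6[of v1 v5 v4 v3 v a] no_path6[of v2 v1 v5 v4 u a] no_path6[of v3 v2 v1 v5 v a]
    no_path6[of v4 v3 v2 v1 u a] no_path6[of v5 v4 v3 v2 v a]
  by (simp_all (no_asm_use) only: finite_simps) satx?

lemma undominated_path2:
  assumes "hole5 v1 v2 v3 v4 v5" "misses a [v1, v2, v3, v4, v5]" "misses b [v1, v2, v3, v4, v5]"
    "\<not> misses u [v1, v2, v3, v4, v5]" "\<not> misses v [v1, v2, v3, v4, v5]" "sees u [a]"
    "misses u [b, v]" "sees a [b]" "misses a [v]" "sees b [v]"
  shows "False"
  using assms no_hole4[of v1 v2 v v5] no_hole4[of v2 v1 v5 u] no_hole4[of v2 v3 v4 v]
    no_hole4[of v3 u v1 v] no_hole4[of v4 v3 v2 u] no_path6[of a b v v1 v2 v3]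
    no_path6[of a b v v3 v4 v5] no_path6[of a b v v4 v5 v1] no_path6[of b a u v2 v1 v5]
    no_path6[of b a u v4 v3 v2] no_path6[of b a u v5 v4 v3] no_path6[of v1 v2 v3 u a b]
    no_path6[of v2 v1 v5 v b a] no_path6[of v4 v3 v2 v b a] no_path6[of v4 v5 v1 u a b]
  by (simp_all (no_asm_use) only: finite_simps) satx?

lemma undominated_path3:
  assumes "hole5 v1 v2 v3 v4 v5" "misses a [v1, v2, v3, v4, v5]" "misses b [v1, v2, v3, v4, v5]"
    "misses c [v1, v2, v3, v4, v5]" "\<not> misses u [v1, v2, v3, v4, v5]"
    "\<not> misses v [v1, v2, v3, v4, v5]" "sees u [a]" "misses u [b, c, v]" "sees a [b]"
    "misses a [c, v]" "sees b [c]" "misses b [v]" "sees c [v]"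
  shows "False"
  using assms no_hole4[of u v2 v v5] no_path6[of a b c v v1 v2] no_path6[of a b c v v5 v1]
    no_path6[of v1 v5 u a b c] no_path6[of v2 v1 u a b c] no_path6[of v3 v2 u a b c]
    no_path6[of v4 v3 u a b c] no_path6[of v5 u a b c v] no_path6[of v5 v4 u a b c]
  by (simp_all (no_asm_use) only: finite_simps) satx?

end

section \<open>Reductions in a minimal counterexample\<close>

locale minimal_counterexample = P6_C4_free +
  fixes w :: nat
  assumes bound: "clique_bound A V w"
    and not_colourable: "\<not> colourable A V (3 * w div 2)"
    and smaller: "W \<subset> V \<Longrightarrow> clique_bound A W m \<Longrightarrow> colourable A W (3 * m div 2)"
begin

lemma smaller_w: "W \<subset> V \<Longrightarrow> colourable A W (3 * w div 2)"
  using smaller[of W w] clique_bound_subset[OF bound, of W] by blast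

lemma card_clique: "K \<subseteq> V \<Longrightarrow> clq A K \<Longrightarrow> card K \<le> w"
  using bound by (simp add: clique_bound_def)

text \<open>Otherwise \<open>v\<close> is coloured last: \<open>nb v\<close> contains
  \<open>v\<close> itself, so fewer than \<open>3 * w div 2\<close> colours are blocked.\<close>

lemma card_nb:
  assumes "v \<in> V" shows "3 * w < 2 * card (nb v)"
proof (rule ccontr)
  assume "\<not> ?thesis"
  then have le: "card (nb v) \<le> 3 * w div 2" by linarith
  have "nb v = insert v {y \<in> V - {v}. A v y}" using assms refl by (auto simp: nb_def)
  moreover have "finite {y \<in> V - {v}. A v y}" using fin by simp
  ultimately have "card {y \<in> V - {v}. A v y} < card (nb v)" by simp
  then have "colourable A (insert v (V - {v})) (3 * w div 2)"
    using fin sym smaller_w[of "V - {v}"] assms le by (intro colourable_insert) auto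
  then show False using not_colourable assms by (simp add: insert_absorb)
qed

text \<open>Every clique of the rest extends by \<open>v\<close>, so deleting \<open>v\<close>
  lowers the clique number by one, and a single new colour for \<open>v\<close> stays within the
  bound.\<close>

lemma no_universal_vertex:
  assumes "v \<in> V" "\<And>y. y \<in> V \<Longrightarrow> A v y" shows False
proof -
  have "clq A {v}" using refl by (simp add: clq_def)
  then have w: "1 \<le> w" using card_clique[of "{v}"] assms(1) by simp
  have "clique_bound A (V - {v}) (w - 1)"
    unfolding clique_bound_def
  proof (intro allI impI)
    fix K assume K: "K \<subseteq> V - {v}" "clq A K"
    have v: "A v z" "A z v" if "z \<in> K" for z using that K assms(2) sym[of v z] by auto
    have "clq A (insert v K)" using K(2) v refl unfolding clq_def by blast
    then have "card (insert v K) \<le> w" using card_clique[of "insert v K"] K assms(1) by blast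
    moreover have "finite K" "v \<notin> K" using K fin finite_subset by blast+
    ultimately show "card K \<le> w - 1" by simp
  qed
  then have "colourable A (V - {v}) (3 * (w - 1) div 2)" using smaller assms(1) by blast
  then have "colourable A (V - {v} \<union> {v}) (3 * (w - 1) div 2 + 1)"
    by (rule colourable_Un) (rule colourable_singleton)
  moreover have "V - {v} \<union> {v} = V" using assms(1) by blast
  moreover have "3 * (w - 1) div 2 + 1 \<le> 3 * w div 2" using w by presburger
  ultimately have "colourable A V (3 * w div 2)" using colourable_mono[of A V] by simp
  then show False using not_colourable by contradiction
qed

text \<open>The attachments of \<open>Y\<close> form a clique separating \<open>Y\<close> from
  \<open>x\<close>. Both sides together with this clique are proper subsets of \<open>V\<close>, so
  minimality colours them and the colourings can be glued.\<close>

lemma no_clique_cutset: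
  assumes "Y \<subseteq> V" "y \<in> Y" "x \<in> V - Y" "\<And>z. z \<in> Y \<Longrightarrow> \<not> A x z"
    and clq: "\<And>u v. \<lbrakk>u \<in> V - Y; v \<in> V - Y; \<exists>z \<in> Y. A u z; \<exists>z \<in> Y. A v z\<rbrakk> \<Longrightarrow> A u v"
  shows False
proof -
  define S where "S = {s \<in> V - Y. \<exists>z \<in> Y. A s z}"
  define X where "X = V - Y - S"
  have S: "clq A S" using clq by (auto simp: clq_def S_def)
  have x: "x \<in> X" using assms(3,4) by (auto simp: X_def S_def)
  have V: "X \<union> Y \<union> S = V" using assms(1) by (auto simp: X_def S_def)
  have "X \<union> S \<subset> V" using V assms(1,2) by (auto simp: X_def S_def)
  moreover have "Y \<union> S \<subset> V" using V x assms(3) by (auto simp: X_def)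
  ultimately have "colourable A (X \<union> S) (3 * w div 2)" "colourable A (Y \<union> S) (3 * w div 2)"
    using smaller_w by blast+
  moreover have "\<not> A a b" if "a \<in> X" "b \<in> Y" for a b
    using that by (auto simp: X_def S_def)
  moreover have "finite S" using fin by (simp add: S_def)
  moreover have "X \<inter> S = {}" "Y \<inter> S = {}" "X \<inter> Y = {}" by (auto simp: X_def S_def)
  ultimately have "colourable A (X \<union> Y \<union> S) (3 * w div 2)"
    using S sym by (intro colourable_glue) auto
  then show False using V not_colourable by simp
qed

text \<open>
  Three colours on one vertex of each bag of a blow-up: every remaining clique extends by two of
  these vertices, so the clique number drops by two.
\<close>

lemma no_3colourable_blowup:
  assumes U: "set us \<subseteq> V" "us \<noteq> []" and col: "colourable A (set us) 3"
    and twins: "\<And>y. y \<in> V \<Longrightarrow> \<exists>u \<in> set us. twin y u us \<and> (\<forall>z \<in> V. A y z \<longrightarrow> A u z)"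
    and edges: "\<And>u. u \<in> set us \<Longrightarrow> \<exists>v \<in> set us. v \<noteq> u \<and> A u v"
  shows False
proof -
  have twin: "A y b = A u b" if "twin y u us" "b \<in> set us" for y u b
    using that by (simp add: twin_def list_all_iff)
  have ext: "card K + 2 \<le> w" if K: "K \<subseteq> V - set us" "clq A K" for K
  proof -
    have "\<exists>u v. u \<in> set us \<and> v \<in> set us \<and> v \<noteq> u \<and> A u v \<and> (\<forall>z \<in> K. A u z \<and> A v z)"
    proof (cases "K = {}")
      case True
      obtain u where "u \<in> set us" using U(2) by (cases us) auto
      then show ?thesis using True edges[of u] by blast
    next
      case False
      then obtain k where k: "k \<in> K" by blast
      then obtain u where u: "u \<in> set us" "twin k u us" "\<forall>z \<in> V. A k z \<longrightarrow> A u z"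
        using twins[of k] K by blast
      have uK: "\<forall>z \<in> K. A u z" using K k u(3) unfolding clq_def by blast
      show ?thesis
      proof (cases "\<forall>y \<in> K. twin y u us")
        case True
        \<comment> \<open>All of \<open>K\<close> lies in the bag of \<open>u\<close>, so any
          neighbour \<open>v\<close> of \<open>u\<close> among the representatives sees all of
          \<open>K\<close>.\<close>
        obtain v where v: "v \<in> set us" "v \<noteq> u" "A u v" using edges u(1) by blast
        have "A v z" if "z \<in> K" for z using True that twin[of z u v] v sym[of v z] by simp
        then show ?thesis using u v uK by blast
      next
        case False
        then obtain y where y: "y \<in> K" "\<not> twin y u us" by blast
        then obtain v where v: "v \<in> set us" "twin y v us" "\<forall>z \<in> V. A y z \<longrightarrow> A v z"
          using twins[of y] K by blast
        have "\<forall>z \<in> K. A v z" using K y v(3) unfolding clq_def by blast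
        \<comment> \<open>\<open>u\<close> sees the clique member \<open>y\<close>, and
          \<open>v\<close> sees all neighbours of \<open>y\<close>; hence two bags that meet
          \<open>K\<close> have adjacent representatives.\<close>
        moreover have "A u v"
        proof -
          have "A y u" using uK y(1) sym[of y u] by simp
          then have "A v u" using v(3) U u(1) by blast
          then show ?thesis using sym[of u v] by simp
        qed
        moreover have "v \<noteq> u" using y v by blast
        ultimately show ?thesis using u v uK by blast
      qed
    qed
    then obtain u v where uv: "u \<in> set us" "v \<in> set us" "v \<noteq> u" "A u v" "\<forall>z \<in> K. A u z \<and> A v z"
      by blast
    have "A z u \<and> A z v" if "z \<in> K" for z using uv(5) that sym[of z u] sym[of z v] by simp
    moreover have "A v u" using uv(4) sym[of v u] by simp
    ultimately have "clq A (insert u (insert v K))"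
      using K(2) uv(4,5) refl unfolding clq_def by blast
    moreover have "insert u (insert v K) \<subseteq> V" using uv U K by blast
    ultimately have "card (insert u (insert v K)) \<le> w" by (rule card_clique[rotated])
    moreover have "finite K" using K fin finite_subset by blast
    moreover have "u \<notin> K" "v \<notin> K" using uv K by blast+
    ultimately show ?thesis using uv(3) by simp
  qed
  have w: "2 \<le> w" using ext[of "{}"] by (simp add: clq_def)
  have "clique_bound A (V - set us) (w - 2)"
    unfolding clique_bound_def
  proof (intro allI impI)
    fix K assume "K \<subseteq> V - set us" "clq A K"
    from ext[OF this] show "card K \<le> w - 2" by simp
  qed
  moreover have "V - set us \<subset> V" using U by (cases us) auto
  ultimately have "colourable A (V - set us) (3 * (w - 2) div 2)" using smaller by blast
  then have "colourable A (V - set us \<union> set us) (3 * (w - 2) div 2 + 3)"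
    using col by (rule colourable_Un)
  moreover have "V - set us \<union> set us = V" using U by blast
  moreover have "3 * (w - 2) div 2 + 3 \<le> 3 * w div 2" using w by presburger
  ultimately have "colourable A V (3 * w div 2)" using colourable_mono[of A V] by simp
  then show False using not_colourable by contradiction
qed

text \<open>Double counting: each element of \<open>nb u\<close> is in some clique and each element
  of both neighbourhoods in two, so the two sizes add up to at most \<open>3 * w\<close>. By
  \<open>card_nb\<close> the sum exceeds this.\<close>

lemma no_clique_cover:
  assumes uv: "u \<in> V" "v \<in> V"
    and P: "\<And>y z. y \<in> V \<Longrightarrow> z \<in> V \<Longrightarrow> P y \<Longrightarrow> P z \<Longrightarrow> A y z"
    and Q: "\<And>y z. y \<in> V \<Longrightarrow> z \<in> V \<Longrightarrow> Q y \<Longrightarrow> Q z \<Longrightarrow> A y z"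
    and R: "\<And>y z. y \<in> V \<Longrightarrow> z \<in> V \<Longrightarrow> R y \<Longrightarrow> R z \<Longrightarrow> A y z"
    and u: "\<And>y. y \<in> V \<Longrightarrow> A y u \<Longrightarrow> P y \<or> Q y \<or> R y"
    and v: "\<And>y. y \<in> V \<Longrightarrow> A y v \<Longrightarrow> P y \<or> Q y \<or> R y"
    and both: "\<And>y. y \<in> V \<Longrightarrow> A y u \<Longrightarrow> A y v \<Longrightarrow> P y \<and> (Q y \<or> R y) \<or> Q y \<and> R y"
  shows False
proof -
  let ?c = "\<lambda>P. \<Sum>y\<in>V. of_bool (P y) :: nat"
  have c: "?c F = card {y \<in> V. F y}" for F
    using fin by (simp add: Collect_conj_eq)
  have small: "?c F \<le> w" if "\<And>y z. y \<in> V \<Longrightarrow> z \<in> V \<Longrightarrow> F y \<Longrightarrow> F z \<Longrightarrow> A y z" for F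
    unfolding c by (rule card_clique) (use that in \<open>simp_all add: clq_def\<close>)
  have "?c (\<lambda>y. A y u) + ?c (\<lambda>y. A y v) \<le> ?c P + ?c Q + ?c R"
    unfolding sum.distrib[symmetric]
  proof (rule sum_mono)
    fix y assume y: "y \<in> V"
    show "of_bool (A y u) + of_bool (A y v) \<le> of_bool (P y) + of_bool (Q y) + (of_bool (R y) :: nat)"
      using u[OF y] v[OF y] both[OF y] by (cases "A y u"; cases "A y v") auto
  qed
  also have "\<dots> \<le> 3 * w" proof -
    have "?c P \<le> w" by (rule small) (rule P)
    moreover have "?c Q \<le> w" by (rule small) (rule Q)
    moreover have "?c R \<le> w" by (rule small) (rule R)
    ultimately show ?thesis by linarith
  qed
  finally have "card (nb u) + card (nb v) \<le> 3 * w"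
    by (simp only: c nb_def sym)
  then show False using card_nb[OF uv(1)] card_nb[OF uv(2)] by linarith
qed

text \<open>Otherwise take a component of the vertices that miss the hole. By
  \<open>connecting_path\<close> and the three lemmas on undominated paths its attachments form a
  clique, which cuts it off from the hole vertex \<open>a\<close> or contains \<open>a\<close> only
  if \<open>a\<close> attaches, which it does not.\<close>

lemma hole5_dominating: "\<not> (hole5 a b c d e \<and> f \<in> V \<and> misses f [a, b, c, d, e])"
proof (intro notI, elim conjE)
  assume h: "hole5 a b c d e" and f: "f \<in> V" "misses f [a, b, c, d, e]"
  define X where "X = {z \<in> V. misses z [a, b, c, d, e]}"
  have fX: "f \<in> X" using f by (simp add: X_def)
  define K where "K = component X f"
  have K: "K \<subseteq> X" using component_subset[OF fX] by (simp add: K_def)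
  have out: "\<not> misses u [a, b, c, d, e]" if "u \<in> V - K" "\<exists>z \<in> K. A u z" for u
    using that component_closed[OF fX] sym unfolding X_def K_def by blast
  show False
  proof (rule no_clique_cutset[of K f a])
    show "K \<subseteq> V" using K by (auto simp: X_def)
    show "f \<in> K" by (simp add: K_def component_self)
    have "a \<notin> X" using refl by (simp add: X_def misses_def)
    then show "a \<in> V - K" using K hole5_in_V[OF h] by blast
    show "\<not> A a z" if "z \<in> K" for z using that K sym by (auto simp: X_def misses_def)
    show "A u v"
      if uv: "u \<in> V - K" "v \<in> V - K" "\<exists>z \<in> K. A u z" "\<exists>z \<in> K. A v z" for u v
    proof (rule ccontr)
      assume n: "\<not> A u v"
      obtain k k' where k: "k \<in> component X f" "k' \<in> component X f" "A u k" "A k' v"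
        using uv sym unfolding K_def by blast
      have m: "\<not> misses u [a, b, c, d, e]" "\<not> misses v [a, b, c, d, e]" using out uv by blast+
      have X: "misses z [a, b, c, d, e]" if "z \<in> component X f" for z
        using that K unfolding K_def X_def by blast
      show False
      proof (rule connecting_path[OF fX k n])
        fix x
        assume "x \<in> component X f" "A u x" "A x v"
        then show False using undominated_path1[OF h _ m] X n by blast
      next
        fix x y
        assume "x \<in> component X f" "y \<in> component X f"
          "sees u [x]" "misses u [y, v]" "sees x [y]" "misses x [v]" "sees y [v]"
        then show False using undominated_path2[OF h _ _ m] X by blast
      next
        fix x y z
        assume "x \<in> component X f" "y \<in> component X f" "z \<in> component X f"
          "sees u [x]" "misses u [y, z, v]" "sees x [y]" "misses x [z, v]" "sees y [z]"
          "misses y [v]" "sees z [v]"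
        then show False using undominated_path3[OF h _ _ _ m] X by blast
      qed
    qed
  qed
qed


subsection \<open>A \<open>6\<close>-hole with a vertex seeing two opposite vertices\<close>

lemma colourable_3: "misses a [b, c] \<Longrightarrow> misses b [c] \<Longrightarrow> colourable A {a, b, c} 1"
  unfolding colourable_def by (rule exI[of _ "\<lambda>_. 0"]) (auto simp: finite_simps)

lemma colourable_4:
  "misses a [b, c, d] \<Longrightarrow> misses b [c, d] \<Longrightarrow> misses c [d] \<Longrightarrow> colourable A {a, b, c, d} 1"
  unfolding colourable_def by (rule exI[of _ "\<lambda>_. 0"]) (auto simp: finite_simps)

lemma adjacent_distinct: "A x y \<Longrightarrow> A x z \<Longrightarrow> \<not> A y z \<Longrightarrow> x \<noteq> y \<and> A x y \<and> A y x"
  using sym by blast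

text \<open>The common neighbours of consecutive hole vertices are the cliques used in the covers
  that follow; a nonadjacent pair \<open>y\<close>, \<open>z\<close> completes a \<open>C4\<close>
  or \<open>P6\<close> with parts of the hole and \<open>v7\<close>.\<close>

lemma pair_common_12:
  assumes "hole6_pair v1 v2 v3 v4 v5 v6 v7" "sees y [v1, v2]" "sees z [v1, v2]"
  shows "A y z"
  using assms no_hole4[of v1 v6 v5 y] no_hole4[of v1 z v4 v7] no_hole4[of v3 v4 y v2]
    no_hole4[of v3 v4 z v2] no_hole4[of v4 v7 v1 y] no_hole4[of v5 v4 v7 z]
    no_hole4[of v6 v1 z v5] no_hole4[of v7 y v5 v4] no_hole4[of y v2 z v6] no_hole4[of z v3 y v1]
    no_hole4[of z v7 y v2] no_path6[of v5 v4 v7 y v2 z] no_path6[of v6 v5 v4 v3 v2 y]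
    no_path6[of v6 v5 v4 v3 v2 z] no_path6[of v6 z v2 v3 v4 v7] no_path6[of v7 v4 v3 v2 y v6]
    no_path6[of y v2 z v7 v4 v5]
  by (simp_all (no_asm_use) only: finite_simps) satx?

lemma pair_common_23:
  assumes "hole6_pair v1 v2 v3 v4 v5 v6 v7" "sees y [v2, v3]" "sees z [v2, v3]"
  shows "A y z"
  using assms no_hole4[of v2 v1 v6 z] no_hole4[of v2 v1 v7 y] no_hole4[of v3 v4 v5 y]
    no_hole4[of v3 y v1 z] no_hole4[of v3 y v7 v4] no_hole4[of v4 z v2 y] no_hole4[of v6 v1 v2 y]
    no_hole4[of v7 z v2 v1] no_hole4[of z v3 v4 v5] no_hole4[of z v3 v4 v7]
    no_path6[of v3 z v5 v6 v1 v7] no_path6[of v5 v6 v1 z v3 y] no_path6[of v6 v1 v7 v4 v3 y]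
    no_path6[of v7 v1 v6 v5 y v3] no_path6[of v7 v4 v5 v6 y v2] no_path6[of v7 v4 v5 v6 z v2]
    no_path6[of y v2 z v4 v5 v6] no_path6[of z v3 v4 v7 v1 v6]
  by (simp_all (no_asm_use) only: finite_simps) satx?

lemma pair_common_34:
  assumes "hole6_pair v1 v2 v3 v4 v5 v6 v7" "sees y [v3, v4]" "sees z [v3, v4]"
  shows "A y z"
  using assms no_hole4[of v1 y v3 v2] no_hole4[of v2 v3 z v1] no_hole4[of v3 y v5 z]
    no_hole4[of v4 v5 v6 y] no_hole4[of v4 v7 v1 y] no_hole4[of v4 z v2 y] no_hole4[of v5 v4 z v6]
    no_hole4[of v7 v1 v6 z] no_hole4[of v7 v4 z v1] no_hole4[of v7 y v6 v1] no_hole4[of v7 z v3 y]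
    no_path6[of v5 v6 v1 v2 v3 y] no_path6[of v5 v6 v1 v2 v3 z] no_path6[of v5 y v3 v2 v1 v7]
    no_path6[of v5 z v3 v2 v1 v7] no_path6[of y v3 z v7 v1 v6] no_path6[of y v4 z v2 v1 v6]
  by (simp_all (no_asm_use) only: finite_simps) satx?

lemma pair_nb_2:
  assumes "hole6_pair v1 v2 v3 v4 v5 v6 v7" "A y v2"
  shows "A y v1 \<or> A y v3 \<or> sees y [v2, v5] \<and> misses y [v1, v3, v4, v6]"
  using assms no_hole4[of v4 v3 v2 y] no_hole4[of v6 y v2 v1] no_path6[of v6 v5 v4 v3 v2 y]
  by (simp_all (no_asm_use) only: finite_simps) satx?

lemma pair_nb_3:
  assumes "hole6_pair v1 v2 v3 v4 v5 v6 v7" "A y v3"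
  shows "A y v2 \<or> A y v4 \<or> sees y [v3, v6] \<and> misses y [v1, v2, v4, v5]"
  using assms no_hole4[of v2 v3 y v1] no_hole4[of v5 v4 v3 y] no_path6[of v5 v6 v1 v2 v3 y]
  by (simp_all (no_asm_use) only: finite_simps) satx?

lemma pair_nb_23:
  assumes "hole6_pair v1 v2 v3 v4 v5 v6 v7" "A y v2" "A y v3"
  shows "A y v1 \<or> A y v4"
  using assms no_hole4[of v2 y v6 v1] no_hole4[of y v2 v1 v7] no_path6[of v6 v1 v7 v4 v3 y]
  by (simp_all (no_asm_use) only: finite_simps) satx?

text \<open>A neighbour of \<open>v2\<close> or \<open>v3\<close> outside the three cliques can only
  see exactly an opposite pair of hole vertices. If there were no such vertex, the cliques would
  cover the neighbourhoods of \<open>v2\<close> and \<open>v3\<close>.\<close>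

lemma pair_25_or_36:
  assumes F: "hole6_pair v1 v2 v3 v4 v5 v6 v7" and V: "v2 \<in> V" "v3 \<in> V"
  obtains (s) s where "s \<in> V" "sees s [v2, v5] \<and> misses s [v1, v3, v4, v6]"
  | (t) t where "t \<in> V" "sees t [v3, v6] \<and> misses t [v1, v2, v4, v5]"
proof -
  have False
    if n: "\<And>y. y \<in> V \<Longrightarrow> \<not> (sees y [v2, v5] \<and> misses y [v1, v3, v4, v6])"
      "\<And>y. y \<in> V \<Longrightarrow> \<not> (sees y [v3, v6] \<and> misses y [v1, v2, v4, v5])"
  proof (rule no_clique_cover[OF V, of "\<lambda>y. sees y [v1, v2]" "\<lambda>y. sees y [v2, v3]"
        "\<lambda>y. sees y [v3, v4]"])
    fix y assume y: "y \<in> V"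
    show "sees y [v1, v2] \<or> sees y [v2, v3] \<or> sees y [v3, v4]" if "A y v2"
      using pair_nb_2[OF F that] n(1)[OF y] that by (auto simp: sees_def)
    show "sees y [v1, v2] \<or> sees y [v2, v3] \<or> sees y [v3, v4]" if "A y v3"
      using pair_nb_3[OF F that] n(2)[OF y] that by (auto simp: sees_def)
    show "sees y [v1, v2] \<and> (sees y [v2, v3] \<or> sees y [v3, v4]) \<or> sees y [v2, v3] \<and> sees y [v3, v4]"
      if "A y v2" "A y v3"
      using pair_nb_23[OF F that] that by (auto simp: sees_def)
  qed (rule pair_common_12[OF F] pair_common_23[OF F] pair_common_34[OF F]; assumption)+
  then show thesis using s t by blast
qed

lemma pair_common_56:
  assumes "hole6_pair v1 v2 v3 v4 v5 v6 v7" "sees t [v3, v6] \<and> misses t [v1, v2, v4, v5]"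
    "sees y [v5, v6]" "sees z [v5, v6]"
  shows "A y z"
  using assms no_hole4[of t y v5 z] no_hole4[of v3 t v6 z] no_hole4[of v3 z v5 v4]
    no_hole4[of v5 y v1 z] no_hole4[of v6 v1 v2 y] no_hole4[of y v2 v3 t] no_hole4[of y v3 t v6]
    no_hole4[of y v3 v4 v5] no_hole4[of y v6 z v4] no_hole4[of z t v3 v2] no_hole4[of z v2 v1 v6]
    no_path6[of t v3 v4 v5 z v1] no_path6[of v1 v2 v3 v4 v5 y] no_path6[of v1 y v5 v4 v3 t]
    no_path6[of v3 v2 v1 y v5 z] no_path6[of y v5 z v1 v2 v3] no_path6[of z v5 v4 v3 v2 v1]
  by (simp_all (no_asm_use) only: finite_simps) satx?

lemma pair_nb_2_only:
  assumes "hole6_pair v1 v2 v3 v4 v5 v6 v7" "sees t [v3, v6] \<and> misses t [v1, v2, v4, v5]"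
    "A y v2" "\<not> (sees y [v2, v5] \<and> misses y [v1, v3, v4, v6])"
  shows "sees y [v1, v2] \<or> sees y [v3, v4]"
  using assms no_hole4[of v1 v6 y v2] no_hole4[of v5 y v3 v4] no_hole4[of y v4 v3 v2]
    no_path6[of v4 v5 v6 v1 v2 y]
  by (simp_all (no_asm_use) only: finite_simps) satx?

lemma pair_nb_5_only:
  assumes "hole6_pair v1 v2 v3 v4 v5 v6 v7" "sees t [v3, v6] \<and> misses t [v1, v2, v4, v5]"
    "A y v5" "\<not> (sees y [v2, v5] \<and> misses y [v1, v3, v4, v6])"
  shows "sees y [v5, v6] \<or> sees y [v3, v4]"
  using assms no_hole4[of t v6 v5 y] no_hole4[of v4 v3 y v5] no_hole4[of v6 v5 y v1]
    no_hole4[of y v4 v3 v2] no_path6[of y v5 v6 t v3 v2]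
  by (simp_all (no_asm_use) only: finite_simps) satx?

lemma pair_nb_25:
  assumes "hole6_pair v1 v2 v3 v4 v5 v6 v7" "sees t [v3, v6] \<and> misses t [v1, v2, v4, v5]"
    "A y v2" "A y v5" "\<not> (sees y [v2, v5] \<and> misses y [v1, v3, v4, v6])"
  shows "sees y [v1, v2, v3, v4]"
  using assms no_hole4[of t y v2 v3] no_hole4[of v4 y v2 v3] no_hole4[of v5 y v3 v4]
    no_hole4[of v7 v1 v2 y] no_hole4[of y v6 v1 v2] no_path6[of t v3 v4 v5 y v1]
    no_path6[of v3 y v5 v6 v1 v7]
  by (simp_all (no_asm_use) only: finite_simps) satx?

text \<open>With \<open>t\<close> present, the cliques on the alternate edges \<open>v1 v2\<close>,
  \<open>v3 v4\<close> and \<open>v5 v6\<close> cover the neighbourhoods of the opposite vertices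
  \<open>v2\<close> and \<open>v5\<close>, apart from the vertices that see exactly these two. So
  such an \<open>s\<close> exists.\<close>

lemma pair_25:
  assumes F: "hole6_pair v1 v2 v3 v4 v5 v6 v7" and V: "v2 \<in> V" "v5 \<in> V"
    and t: "sees t [v3, v6] \<and> misses t [v1, v2, v4, v5]"
  obtains s where "s \<in> V" "sees s [v2, v5] \<and> misses s [v1, v3, v4, v6]"
proof -
  have False
    if n: "\<And>y. y \<in> V \<Longrightarrow> \<not> (sees y [v2, v5] \<and> misses y [v1, v3, v4, v6])"
  proof (rule no_clique_cover[OF V, of "\<lambda>y. sees y [v1, v2]" "\<lambda>y. sees y [v3, v4]"
        "\<lambda>y. sees y [v5, v6]"])
    fix y assume y: "y \<in> V"
    show "sees y [v1, v2] \<or> sees y [v3, v4] \<or> sees y [v5, v6]" if "A y v2"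
      using pair_nb_2_only[OF F t that n[OF y]] by blast
    show "sees y [v1, v2] \<or> sees y [v3, v4] \<or> sees y [v5, v6]" if "A y v5"
      using pair_nb_5_only[OF F t that n[OF y]] by blast
    show "sees y [v1, v2] \<and> (sees y [v3, v4] \<or> sees y [v5, v6]) \<or> sees y [v3, v4] \<and> sees y [v5, v6]"
      if "A y v2" "A y v5"
      using pair_nb_25[OF F t that n[OF y]] that by (auto simp: sees_def)
  qed (rule pair_common_12[OF F] pair_common_34[OF F] pair_common_56[OF F t]; assumption)+
  then show thesis using that by blast
qed

section \<open>Completion to the Petersen graph\<close>

lemma pair_common_47:
  assumes "hole6_pair v1 v2 v3 v4 v5 v6 v7" "sees s [v2, v5] \<and> misses s [v1, v3, v4, v6]"
    "sees t [v3, v6] \<and> misses t [v1, v2, v4, v5]" "sees y [v4, v7]" "sees z [v4, v7]"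
  shows "A y z"
  using assms no_hole4[of s v2 v3 z] no_hole4[of t z v4 v3] no_hole4[of v1 v2 z v7]
    no_hole4[of v5 z v7 y] no_hole4[of v6 v5 v4 z] no_hole4[of v7 z v3 y] no_hole4[of y s v5 v4]
    no_hole4[of y v4 v3 v2] no_hole4[of y v4 z v1] no_hole4[of y v5 v6 t] no_hole4[of y v7 v1 v6]
    no_hole4[of z v6 v1 v7] no_path6[of v5 v6 v1 v7 y v3] no_path6[of v5 v6 v1 v7 z v3]
    no_path6[of v6 v1 v2 v3 v4 y] no_path6[of y v4 z v1 v6 t] no_path6[of z v4 v3 t v6 v1]
    no_path6[of z v4 y v1 v2 s]
  by (simp_all (no_asm_use) only: finite_simps) satx?

lemma pair_common_16:
  assumes "hole6_pair v1 v2 v3 v4 v5 v6 v7" "sees s [v2, v5] \<and> misses s [v1, v3, v4, v6]"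
    "sees t [v3, v6] \<and> misses t [v1, v2, v4, v5]" "sees y [v1, v6]" "sees z [v1, v6]"
  shows "A y z"
  using assms no_hole4[of v1 y v3 v2] no_hole4[of v4 y v1 v7] no_hole4[of v4 y v6 v5]
    no_hole4[of v4 z v6 v5] no_hole4[of v5 s z v6] no_hole4[of v6 z v2 y] no_hole4[of v6 z v3 t]
    no_hole4[of v7 v4 v3 y] no_hole4[of v7 v4 z v1] no_hole4[of v7 y v6 z] no_hole4[of y v1 z v5]
    no_hole4[of z t y v1] no_hole4[of z v3 v2 v1] no_path6[of v3 v4 v7 y v6 z]
    no_path6[of v3 v4 v7 z v6 y] no_path6[of v5 y v1 v2 v3 t] no_path6[of v7 v4 v3 v2 z v6]
    no_path6[of v7 v4 v5 v6 y v2] no_path6[of y v1 v2 v3 v4 v5] no_path6[of z v1 v2 s v5 v4]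
  by (simp_all (no_asm_use) only: finite_simps) satx?

lemma pair_common_3t:
  assumes "hole6_pair v1 v2 v3 v4 v5 v6 v7" "sees s [v2, v5] \<and> misses s [v1, v3, v4, v6]"
    "sees t [v3, v6] \<and> misses t [v1, v2, v4, v5]" "sees y [v3, t]" "sees z [v3, t]"
    "v4 \<in> V"
  shows "A y z"
  using assms no_hole4[of t y v4 z] no_hole4[of t z v5 v6] no_hole4[of v1 v6 t y]
    no_hole4[of v1 y v3 v2] no_hole4[of v2 s z v3] no_hole4[of v2 z v7 v1] no_hole4[of v3 y v6 z]
    no_hole4[of v5 s y v4] no_hole4[of v5 v4 v3 z] no_hole4[of v5 v6 t y] no_hole4[of v6 t z v1]
    no_hole4[of y t z v2] no_hole4[of y v6 v1 v7] no_path6[of s v5 v6 z v3 y]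
    no_path6[of v5 v6 v1 v2 v3 y] no_path6[of z v3 v2 s v5 v6] no_path6[of z v3 y v6 v1 v7]
    hole5_dominating[of t v6 v1 v2 y v4]
  by (simp_all (no_asm_use) only: finite_simps) satx?

lemma pair_nb_7:
  assumes "hole6_pair v1 v2 v3 v4 v5 v6 v7" "sees s [v2, v5] \<and> misses s [v1, v3, v4, v6]"
    "sees t [v3, v6] \<and> misses t [v1, v2, v4, v5]" "A y v7"
    "\<not> misses y [v1, v2, v3, v4, v5, v6]"
  shows "A y v4 \<or> sees y [v1, v6]"
  using assms no_hole4[of v1 v2 y v7] no_hole4[of v6 y v7 v1] no_hole4[of v7 v4 v3 y]
    no_hole4[of y v5 v4 v7] no_path6[of y v1 v6 v5 v4 v3]
  by (simp_all (no_asm_use) only: finite_simps) satx?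

lemma pair_nb_t:
  assumes "hole6_pair v1 v2 v3 v4 v5 v6 v7" "sees s [v2, v5] \<and> misses s [v1, v3, v4, v6]"
    "sees t [v3, v6] \<and> misses t [v1, v2, v4, v5]" "A y t"
    "\<not> misses y [v1, v2, v3, v4, v5, v6]" "v1 \<in> V"
  shows "A y v3 \<or> sees y [v1, v6]"
  using assms no_hole4[of t v6 v1 y] no_hole4[of t y v4 v3] no_hole4[of v3 v2 y t]
    no_path6[of y v6 v5 v4 v3 v2] hole5_dominating[of v4 v3 t y v5 v1]
  by (simp_all (no_asm_use) only: finite_simps) satx?

lemma pair_nb_7t:
  assumes "hole6_pair v1 v2 v3 v4 v5 v6 v7" "sees s [v2, v5] \<and> misses s [v1, v3, v4, v6]"
    "sees t [v3, v6] \<and> misses t [v1, v2, v4, v5]" "A y v7" "A y t"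
    "\<not> misses y [v1, v2, v3, v4, v5, v6]" "v5 \<in> V"
  shows "sees y [v1, v3, v4, v6]"
  using assms no_hole4[of t v3 v4 y] no_hole4[of v1 y t v6] no_hole4[of v2 y v7 v1]
    no_hole4[of v4 v7 y v3] no_hole4[of y t v6 v5] no_hole4[of y v6 v1 v7] no_hole4[of y v7 v4 v5]
    no_path6[of v1 y t v3 v4 v5] hole5_dominating[of v3 v2 v1 v7 y v5]
  by (simp_all (no_asm_use) only: finite_simps) satx?

text \<open>The cover at \<open>v7\<close> and \<open>t\<close> fails only because of vertices that
  miss the whole 6-hole.\<close>

lemma pair_7:
  assumes F: "hole6_pair v1 v2 v3 v4 v5 v6 v7" and V: "{v1, v2, v3, v4, v5, v6, v7} \<subseteq> V"
    and s: "sees s [v2, v5] \<and> misses s [v1, v3, v4, v6]"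
    and t: "sees t [v3, v6] \<and> misses t [v1, v2, v4, v5]" and tV: "t \<in> V"
  obtains r where "r \<in> V" "misses r [v1, v2, v3, v4, v5, v6]"
proof -
  have False if n: "\<And>y. y \<in> V \<Longrightarrow> \<not> misses y [v1, v2, v3, v4, v5, v6]"
  proof (rule no_clique_cover[OF _ tV, of v7 "\<lambda>y. sees y [v4, v7]" "\<lambda>y. sees y [v1, v6]"
        "\<lambda>y. sees y [v3, t]"])
    show "v7 \<in> V" using V by simp
    fix y assume y: "y \<in> V"
    show "sees y [v4, v7] \<or> sees y [v1, v6] \<or> sees y [v3, t]" if "A y v7"
      using pair_nb_7[OF F s t that n[OF y]] V that by (auto simp: sees_def)
    show "sees y [v4, v7] \<or> sees y [v1, v6] \<or> sees y [v3, t]" if "A y t"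
      using pair_nb_t[OF F s t that n[OF y]] V that by (auto simp: sees_def)
    show "sees y [v4, v7] \<and> (sees y [v1, v6] \<or> sees y [v3, t]) \<or> sees y [v1, v6] \<and> sees y [v3, t]"
      if "A y v7" "A y t"
      using pair_nb_7t[OF F s t that n[OF y]] V that by (auto simp: sees_def)
  qed (use V in \<open>auto intro: pair_common_47[OF F s t] pair_common_16[OF F s t] pair_common_3t[OF F s t]\<close>)
  then show thesis using that by blast
qed

text \<open>Each of \<open>v7\<close>, \<open>s\<close> and \<open>t\<close> splits the 6-hole into
  two 5-holes, and domination of these forces \<open>r\<close> to see all three of them. An edge
  among \<open>v7\<close>, \<open>s\<close> and \<open>t\<close> would give a \<open>C4\<close> or
  an undominated 5-hole.\<close>

lemma pair_extends_to_petersen: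
  assumes "hole6_pair v1 v2 v3 v4 v5 v6 v7" "sees s [v2, v5] \<and> misses s [v1, v3, v4, v6]"
    "sees t [v3, v6] \<and> misses t [v1, v2, v4, v5]" "misses r [v1, v2, v3, v4, v5, v6]"
    "v1 \<in> V" "v6 \<in> V" "r \<in> V"
  shows "petersen v1 v2 v3 v4 v5 v6 v7 r s t"
  using assms no_hole4[of t v6 v1 v7] hole5_dominating[of s t v3 v4 v5 v1]
    hole5_dominating[of v1 v2 v3 v4 v7 r] hole5_dominating[of v2 v1 v6 v5 s r]
    hole5_dominating[of v3 v4 v7 s v2 v6] hole5_dominating[of v6 v1 v2 v3 t r]
  by (simp_all (no_asm_use) only: finite_simps) satx?

section \<open>Graphs around an induced Petersen graph\<close>

lemma petersen_types:
  assumes "petersen v1 v2 v3 v4 v5 v6 v7 r s t" "v7 \<in> V" "s \<in> V" "y \<in> V"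
  shows "twinned y [v1, v2, v3, v4, v5, v6, v7, r, s, t] \<or> sees y [v1, v2, v3, v4, v5, v6,
    v7, r, s, t]"
  using assms no_hole4[of s r v7 y] no_hole4[of s v2 v1 y] no_hole4[of s v2 v3 y]
    no_hole4[of s v2 y v5] no_hole4[of v1 v7 v4 y] no_hole4[of v1 y r v7] no_hole4[of v1 y t v6]
    no_hole4[of v1 y v3 v2] no_hole4[of v1 y v5 v6] no_hole4[of v3 t r y] no_hole4[of v3 v2 y t]
    no_hole4[of v4 v3 t y] no_hole4[of v4 v3 y v5] no_hole4[of v4 v3 y v7] no_hole4[of v5 v6 t y]
    no_hole4[of v6 v1 v7 y] no_hole4[of v6 y r t] no_hole4[of v6 y v2 v1] no_hole4[of v6 y v4 v5]
    no_hole4[of v7 v4 y r] no_hole4[of y s v5 v6] no_hole4[of y v4 v3 v2] no_hole4[of y v4 v5 s]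
    no_hole4[of y v7 v4 v5] no_path6[of y s r t v3 v4] no_path6[of y v1 v7 r s v5]
    hole5_dominating[of r s v2 v1 v7 y] hole5_dominating[of r t v3 v2 s y]
    hole5_dominating[of t v3 v2 v1 v6 y] hole5_dominating[of t v3 v4 v5 v6 y]
    hole5_dominating[of v1 v7 y t v6 s] hole5_dominating[of v3 v2 v1 v7 v4 y]
    hole5_dominating[of v5 s v2 v3 v4 y] hole5_dominating[of v5 v6 t v3 y v7]
    hole5_dominating[of v6 t r s v5 y] hole5_dominating[of v7 v4 v5 v6 v1 y]
  by (simp_all (no_asm_use) only: finite_simps) satx?

text \<open>Either kind of \<open>z\<close> sees two nonadjacent vertices of the Petersen graph,
  which \<open>y\<close> sees as well; if \<open>y\<close> and \<open>z\<close> were nonadjacent,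
  the four would form a \<open>C4\<close>. With \<open>petersen_types\<close> this makes
  \<open>y\<close> universal in the whole graph.\<close>

lemma petersen_universal:
  assumes "petersen v1 v2 v3 v4 v5 v6 v7 r s t" "sees y [v1, v2, v3, v4, v5, v6, v7, r, s, t]"
    "twinned z [v1, v2, v3, v4, v5, v6, v7, r, s, t] \<or> sees z [v1, v2, v3, v4, v5, v6, v7, r,
      s, t]"
  shows "A y z"
  using assms no_hole4[of s y v3 z] no_hole4[of t y v1 z] no_hole4[of v4 y r z]
    no_hole4[of v5 z r y] no_hole4[of v6 y v4 z] no_hole4[of v7 z t y] no_hole4[of y v4 z t]
    no_hole4[of y v7 z v3] no_hole4[of z v3 y v6] no_hole4[of z v6 y v7]
  by (simp_all (no_asm_use) only: finite_simps) satx?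

lemma petersen_twin:
  assumes "petersen v1 v2 v3 v4 v5 v6 v7 r s t" "twin y v1 [v1, v2, v3, v4, v5, v6, v7, r, s, t]"
    "A y z" "z \<in> V"
  shows "A v1 z"
  using assms no_hole4[of r v7 y z] no_hole4[of s v2 y z] no_hole4[of v1 v2 z v7]
    no_hole4[of v6 y z t] no_hole4[of v6 z v2 v1] no_hole4[of v7 z v6 v1] no_hole4[of y v6 v5 z]
    no_path6[of z v6 v1 v7 r s] hole5_dominating[of v1 v2 s v5 v6 z]
    hole5_dominating[of v1 v6 t r v7 z]
  by (simp_all (no_asm_use) only: finite_simps) satx?

text \<open>The Petersen graph is vertex-transitive: each instance relabels it by an automorphism
  carrying \<open>v1\<close> to the vertex in question.\<close>

lemma petersen_twin_all:
  assumes "petersen v1 v2 v3 v4 v5 v6 v7 r s t" "z \<in> V" "A y z"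
    and "u \<in> set [v1, v2, v3, v4, v5, v6, v7, r, s, t]"
    and "twin y u [v1, v2, v3, v4, v5, v6, v7, r, s, t]" (is "twin _ _ ?us")
  shows "A u z"
proof -
  have "A v1 z" if "twin y v1 ?us"
    by (rule petersen_twin[of v1 v2 v3 v4 v5 v6 v7 r s t])
      (use assms that in \<open>simp_all only: finite_simps\<close>)
  moreover have "A v2 z" if "twin y v2 ?us"
    by (rule petersen_twin[of v2 v1 v6 v5 v4 v3 s r v7 t])
      (use assms that in \<open>simp_all only: finite_simps\<close>)
  moreover have "A v3 z" if "twin y v3 ?us"
    by (rule petersen_twin[of v3 v2 v1 v6 v5 v4 t r s v7])
      (use assms that in \<open>simp_all only: finite_simps\<close>)
  moreover have "A v4 z" if "twin y v4 ?us"
    by (rule petersen_twin[of v4 v3 v2 v1 v6 v5 v7 r t s])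
      (use assms that in \<open>simp_all only: finite_simps\<close>)
  moreover have "A v5 z" if "twin y v5 ?us"
    by (rule petersen_twin[of v5 v4 v3 v2 v1 v6 s r v7 t])
      (use assms that in \<open>simp_all only: finite_simps\<close>)
  moreover have "A v6 z" if "twin y v6 ?us"
    by (rule petersen_twin[of v6 v1 v2 v3 v4 v5 t r v7 s])
      (use assms that in \<open>simp_all only: finite_simps\<close>)
  moreover have "A v7 z" if "twin y v7 ?us"
    by (rule petersen_twin[of v7 v1 v2 v3 t r v4 v5 v6 s])
      (use assms that in \<open>simp_all only: finite_simps\<close>)
  moreover have "A r z" if "twin y r ?us"
    by (rule petersen_twin[of r v7 v1 v2 v3 t s v5 v4 v6])
      (use assms that in \<open>simp_all only: finite_simps\<close>)
  moreover have "A s z" if "twin y s ?us"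
    by (rule petersen_twin[of s v2 v1 v6 t r v5 v4 v3 v7])
      (use assms that in \<open>simp_all only: finite_simps\<close>)
  moreover have "A t z" if "twin y t ?us"
    by (rule petersen_twin[of t v3 v2 v1 v7 r v6 v5 v4 s])
      (use assms that in \<open>simp_all only: finite_simps\<close>)
  ultimately show ?thesis using assms(4,5) by auto
qed

lemma no_petersen:
  assumes P: "petersen v1 v2 v3 v4 v5 v6 v7 r s t"
    and V: "set [v1, v2, v3, v4, v5, v6, v7, r, s, t] \<subseteq> V" (is "set ?us \<subseteq> V")
  shows False
proof (rule no_3colourable_blowup[OF V])
  have "misses v1 [v3, v5, r]" "misses v3 [v5, r]" "misses v5 [r]"
      "misses v2 [v4, v6]" "misses v4 [v6]" "misses v7 [s, t]" "misses s [t]"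
    using P by (simp_all only: finite_simps)
  then have "colourable A ({v1, v3, v5, r} \<union> {v2, v4, v6} \<union> {v7, s, t}) (1 + 1 + 1)"
    by (intro colourable_Un colourable_3 colourable_4)
  moreover have "{v1, v3, v5, r} \<union> {v2, v4, v6} \<union> {v7, s, t} = set ?us" by auto
  ultimately show "colourable A (set ?us) 3" by (simp only: one_add_one numeral_plus_one) simp
  have mem: "v7 \<in> V" "s \<in> V" using V by simp_all
  show "\<exists>u \<in> set ?us. twin y u ?us \<and> (\<forall>z \<in> V. A y z \<longrightarrow> A u z)" if y: "y \<in> V" for y
  proof -
    have "\<not> sees y ?us"
    proof
      assume "sees y ?us"
      then have "A y z" if "z \<in> V" for z
        using petersen_universal[OF P] petersen_types[OF P mem that] by blast
      then show False using no_universal_vertex[OF y] by blast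
    qed
    then have "twinned y ?us" using petersen_types[OF P mem y] by blast
    then obtain u where "u \<in> set ?us" "twin y u ?us"
      unfolding twinned_def list_ex_iff by blast
    then show ?thesis using petersen_twin_all[OF P] by blast
  qed
  \<comment> \<open>Six edges that together meet all ten vertices, so that every vertex has a
    neighbour among the representatives.\<close>
  have "v1 \<noteq> v2 \<and> A v1 v2 \<and> A v2 v1" by (rule adjacent_distinct[of _ _ v6]) (use P in \<open>simp_all only: finite_simps\<close>)
  moreover have "v3 \<noteq> v4 \<and> A v3 v4 \<and> A v4 v3" by (rule adjacent_distinct[of _ _ v2]) (use P in \<open>simp_all only: finite_simps\<close>)
  moreover have "v5 \<noteq> v6 \<and> A v5 v6 \<and> A v6 v5" by (rule adjacent_distinct[of _ _ v4]) (use P in \<open>simp_all only: finite_simps\<close>)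
  moreover have "v7 \<noteq> r \<and> A v7 r \<and> A r v7" by (rule adjacent_distinct[of _ _ v1]) (use P in \<open>simp_all only: finite_simps\<close>)
  moreover have "s \<noteq> v2 \<and> A s v2 \<and> A v2 s" by (rule adjacent_distinct[of _ _ v5]) (use P in \<open>simp_all only: finite_simps\<close>)
  moreover have "t \<noteq> v3 \<and> A t v3 \<and> A v3 t" by (rule adjacent_distinct[of _ _ v6]) (use P in \<open>simp_all only: finite_simps\<close>)
  ultimately show "\<exists>v \<in> set ?us. v \<noteq> u \<and> A u v" if "u \<in> set ?us" for u
    using that by auto
qed simp

lemma no_hole6_pair: "\<not> hole6_pair v1 v2 v3 v4 v5 v6 v7"
proof
  assume F: "hole6_pair v1 v2 v3 v4 v5 v6 v7"
  have h: "hole6 v1 v2 v3 v4 v5 v6" using F by (simp add: hole6_pair_def)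
  have "A v7 v1" "A v7 v4" "\<not> A v1 v4" using F by (simp_all only: finite_simps)
  then have V: "{v1, v2, v3, v4, v5, v6, v7} \<subseteq> V"
    using hole6_in_V[OF h] in_V2[of v7 v1 v4] by simp
  \<comment> \<open>The reflection that exchanges \<open>v1\<close> with \<open>v4\<close>,
    \<open>v2\<close> with \<open>v3\<close> and \<open>v5\<close> with \<open>v6\<close>; it fixes
    \<open>v7\<close> and swaps the roles of \<open>s\<close> and \<open>t\<close>.\<close>
  have F': "hole6_pair v4 v3 v2 v1 v6 v5 v7" using F by (simp only: finite_simps)
  have both: False
    if s: "s \<in> V" "sees s [v2, v5] \<and> misses s [v1, v3, v4, v6]"
      and t: "t \<in> V" "sees t [v3, v6] \<and> misses t [v1, v2, v4, v5]" for s t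
  proof -
    obtain r where r: "r \<in> V" "misses r [v1, v2, v3, v4, v5, v6]"
      using pair_7[OF F V s(2) t(2,1)] .
    have "petersen v1 v2 v3 v4 v5 v6 v7 r s t"
      using pair_extends_to_petersen[OF F s(2) t(2) r(2)] r(1) V by simp
    then show False using no_petersen[of v1 v2 v3 v4 v5 v6 v7 r s t] V r(1) s(1) t(1) by simp
  qed
  have mem: "v2 \<in> V" "v3 \<in> V" "v5 \<in> V" "v6 \<in> V" using V by simp_all
  show False
  proof (rule pair_25_or_36[OF F mem(1,2)])
    fix t assume t: "t \<in> V" "sees t [v3, v6] \<and> misses t [v1, v2, v4, v5]"
    show False by (rule pair_25[OF F mem(1,3) t(2)]) (rule both[OF _ _ t])
  next
    fix s assume s: "s \<in> V" "sees s [v2, v5] \<and> misses s [v1, v3, v4, v6]"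
    have s': "sees s [v2, v5] \<and> misses s [v4, v3, v1, v6]" using s(2) by (auto simp: misses_def)
    obtain t where "t \<in> V" "sees t [v3, v6] \<and> misses t [v4, v2, v1, v5]"
      using pair_25[OF F' mem(2,4) s'] .
    then show False using both[OF s, of t] by (auto simp: misses_def)
  qed
qed

subsection \<open>A \<open>6\<close>-hole with a vertex seeing four consecutive vertices\<close>

text \<open>Only the nonadjacency of the new vertices needs an argument: an edge between them would
  close a \<open>C4\<close> with \<open>v2 v3\<close>. The other two nonadjacencies are part of the
  hypotheses.\<close>

lemma quad_extends_to_quad3:
  assumes "hole6_quad v1 v2 v3 v4 v5 v6 v7"
    "sees v8 [v3, v4, v5, v6] \<and> misses v8 [v1, v2, v7]"
    "sees v9 [v1, v2, v5, v6] \<and> misses v9 [v3, v4, v7]"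
  shows "quad3 v1 v2 v3 v4 v5 v6 v7 v8 v9"
  using assms no_hole4[of v3 v8 v9 v2]
  by (simp_all (no_asm_use) only: finite_simps) satx?

lemma quad3_types:
  assumes "quad3 v1 v2 v3 v4 v5 v6 v7 v8 v9" "y \<in> V"
  shows "twinned y [v1, v2, v3, v4, v5, v6, v7, v8, v9] \<or> sees y [v1, v2, v3, v4, v5, v6, v7,
    v8, v9]"
  using assms no_hole4[of v1 v2 y v6] no_hole4[of v1 v6 v8 y] no_hole4[of v1 v7 v3 y]
    no_hole4[of v1 y v3 v2] no_hole4[of v2 v3 v8 y] no_hole4[of v2 y v6 v9]
    no_hole4[of v3 y v5 v4] no_hole4[of v4 v7 y v8] no_hole4[of v4 y v2 v3]
    no_hole4[of v4 y v9 v5] no_hole4[of v5 v4 v7 y] no_hole4[of v5 v4 y v6]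
    no_hole4[of v5 y v1 v6] no_hole4[of v6 v8 v3 y] no_hole4[of v7 v1 v9 y]
    no_hole4[of v7 v4 y v1] no_hole4[of v7 y v6 v1] no_hole4[of v8 v5 y v3]
    no_hole4[of v9 v2 v7 y] no_hole4[of v9 v5 y v1] no_hole4[of v9 v5 y v2]
    no_hole4[of v9 y v8 v6] no_hole4[of y v2 v7 v4] no_hole4[of y v3 v2 v9]
    no_path6[of v1 v2 v3 v4 v5 y] no_path6[of v1 v2 v3 v8 v5 y] no_path6[of v2 v1 v6 v5 v4 y]
    no_path6[of v2 v3 v4 v5 v6 y] no_path6[of v4 v8 v6 v9 v2 y] no_path6[of v5 v8 v3 v7 v1 y]
    no_path6[of v6 v9 v2 v3 v4 y] no_path6[of v8 v5 v9 v1 v7 y] no_path6[of y v1 v6 v5 v4 v3]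
    no_path6[of y v4 v7 v2 v9 v6] no_path6[of y v5 v9 v1 v7 v3] no_path6[of y v6 v8 v4 v7 v2]
    hole5_dominating[of v8 v4 v7 v1 v6 y] hole5_dominating[of v9 v1 v7 v4 v5 y]
  by (simp_all (no_asm_use) only: finite_simps) satx?

lemma quad3_universal:
  assumes "quad3 v1 v2 v3 v4 v5 v6 v7 v8 v9" "sees y [v1, v2, v3, v4, v5, v6, v7, v8, v9]"
    "twinned z [v1, v2, v3, v4, v5, v6, v7, v8, v9] \<or> sees z [v1, v2, v3, v4, v5, v6, v7, v8,
      v9]"
  shows "A y z"
  using assms no_hole4[of v6 z v2 y] no_hole4[of v6 z v4 y] no_hole4[of y v1 z v3]
    no_hole4[of y v9 z v8] no_hole4[of z v7 y v8]
  by (simp_all (no_asm_use) only: finite_simps) satx?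

lemma quad3_twin_1:
  assumes "quad3 v1 v2 v3 v4 v5 v6 v7 v8 v9" "twin y v1 [v1, v2, v3, v4, v5, v6, v7, v8, v9]"
    "A y z" "z \<in> V"
  shows "A v1 z"
  using assms no_hole4[of v1 v6 z v2] no_hole4[of v3 z y v2] no_hole4[of v5 v4 z v6]
    no_hole4[of v9 v1 v7 z] no_hole4[of z v5 v9 y] no_hole4[of z y v6 v8] no_hole4[of z y v7 v4]
    no_path6[of v4 v3 v2 v1 v6 z] no_path6[of v8 v5 v9 v1 v7 z]
    hole5_dominating[of v4 v7 v1 v6 v8 z]
  by (simp_all (no_asm_use) only: finite_simps) satx?

lemma quad3_twin_7:
  assumes "quad3 v1 v2 v3 v4 v5 v6 v7 v8 v9" "twin y v7 [v1, v2, v3, v4, v5, v6, v7, v8, v9]"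
    "A y z" "z \<in> V"
  shows "A v7 z"
  using assms no_hole4[of v1 v6 z y] no_hole4[of v1 z v4 v7] no_hole4[of v2 v9 v6 z]
    no_hole4[of v5 v4 y z] no_hole4[of v5 v8 z v9] no_hole4[of v7 v1 z v3] no_hole4[of v9 z y v1]
    no_hole4[of z v4 v7 v2] no_path6[of v5 v8 v3 v7 v1 z] no_path6[of v6 v5 v4 v7 v2 z]
    no_path6[of v6 v9 v2 v7 v4 z] hole5_dominating[of v2 v7 v4 v5 v9 z]
  by (simp_all (no_asm_use) only: finite_simps) satx?

text \<open>The symmetries of the graph are those of a triangle; the six hole vertices are
  equivalent, and so are the three further vertices. Hence two representative cases suffice.\<close>

lemma quad3_twin_all:
  assumes "quad3 v1 v2 v3 v4 v5 v6 v7 v8 v9" "z \<in> V" "A y z"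
    and "u \<in> set [v1, v2, v3, v4, v5, v6, v7, v8, v9]"
    and "twin y u [v1, v2, v3, v4, v5, v6, v7, v8, v9]" (is "twin _ _ ?us")
  shows "A u z"
proof -
  have "A v1 z" if "twin y v1 ?us"
    by (rule quad3_twin_1[of v1 v2 v3 v4 v5 v6 v7 v8 v9])
      (use assms that in \<open>simp_all only: finite_simps\<close>)
  moreover have "A v2 z" if "twin y v2 ?us"
    by (rule quad3_twin_1[of v2 v1 v6 v5 v4 v3 v9 v8 v7])
      (use assms that in \<open>simp_all only: finite_simps\<close>)
  moreover have "A v3 z" if "twin y v3 ?us"
    by (rule quad3_twin_1[of v3 v4 v5 v6 v1 v2 v8 v9 v7])
      (use assms that in \<open>simp_all only: finite_simps\<close>)
  moreover have "A v4 z" if "twin y v4 ?us"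
    by (rule quad3_twin_1[of v4 v3 v2 v1 v6 v5 v7 v9 v8])
      (use assms that in \<open>simp_all only: finite_simps\<close>)
  moreover have "A v5 z" if "twin y v5 ?us"
    by (rule quad3_twin_1[of v5 v6 v1 v2 v3 v4 v9 v7 v8])
      (use assms that in \<open>simp_all only: finite_simps\<close>)
  moreover have "A v6 z" if "twin y v6 ?us"
    by (rule quad3_twin_1[of v6 v5 v4 v3 v2 v1 v8 v7 v9])
      (use assms that in \<open>simp_all only: finite_simps\<close>)
  moreover have "A v7 z" if "twin y v7 ?us"
    by (rule quad3_twin_7[of v1 v2 v3 v4 v5 v6 v7 v8 v9])
      (use assms that in \<open>simp_all only: finite_simps\<close>)
  moreover have "A v8 z" if "twin y v8 ?us"
    by (rule quad3_twin_7[of v3 v4 v5 v6 v1 v2 v8 v9 v7])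
      (use assms that in \<open>simp_all only: finite_simps\<close>)
  moreover have "A v9 z" if "twin y v9 ?us"
    by (rule quad3_twin_7[of v2 v1 v6 v5 v4 v3 v9 v8 v7])
      (use assms that in \<open>simp_all only: finite_simps\<close>)
  ultimately show ?thesis using assms(4,5) by auto
qed

lemma no_quad3:
  assumes Q: "quad3 v1 v2 v3 v4 v5 v6 v7 v8 v9"
    and V: "set [v1, v2, v3, v4, v5, v6, v7, v8, v9] \<subseteq> V" (is "set ?us \<subseteq> V")
  shows False
proof (rule no_3colourable_blowup[OF V])
  have "misses v1 [v3, v5]" "misses v3 [v5]" "misses v2 [v4, v6]" "misses v4 [v6]"
      "misses v7 [v8, v9]" "misses v8 [v9]"
    using Q by (simp_all only: finite_simps)
  then have "colourable A ({v1, v3, v5} \<union> {v2, v4, v6} \<union> {v7, v8, v9}) (1 + 1 + 1)"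
    by (intro colourable_Un colourable_3)
  moreover have "{v1, v3, v5} \<union> {v2, v4, v6} \<union> {v7, v8, v9} = set ?us" by auto
  ultimately show "colourable A (set ?us) 3" by (simp only: one_add_one numeral_plus_one) simp
  show "\<exists>u \<in> set ?us. twin y u ?us \<and> (\<forall>z \<in> V. A y z \<longrightarrow> A u z)" if y: "y \<in> V" for y
  proof -
    have "\<not> sees y ?us"
    proof
      assume "sees y ?us"
      then have "A y z" if "z \<in> V" for z
        using quad3_universal[OF Q] quad3_types[OF Q that] by blast
      then show False using no_universal_vertex[OF y] by blast
    qed
    then have "twinned y ?us" using quad3_types[OF Q y] by blast
    then obtain u where "u \<in> set ?us" "twin y u ?us"
      unfolding twinned_def list_ex_iff by blast
    then show ?thesis using quad3_twin_all[OF Q] by blast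
  qed
  have "v1 \<noteq> v2 \<and> A v1 v2 \<and> A v2 v1"
    by (rule adjacent_distinct[of _ _ v6]) (use Q in \<open>simp_all only: finite_simps\<close>)
  moreover have "v3 \<noteq> v4 \<and> A v3 v4 \<and> A v4 v3"
    by (rule adjacent_distinct[of _ _ v2]) (use Q in \<open>simp_all only: finite_simps\<close>)
  moreover have "v5 \<noteq> v6 \<and> A v5 v6 \<and> A v6 v5"
    by (rule adjacent_distinct[of _ _ v4]) (use Q in \<open>simp_all only: finite_simps\<close>)
  moreover have "v7 \<noteq> v1 \<and> A v7 v1 \<and> A v1 v7"
    by (rule adjacent_distinct[of _ _ v3]) (use Q in \<open>simp_all only: finite_simps\<close>)
  moreover have "v8 \<noteq> v3 \<and> A v8 v3 \<and> A v3 v8"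
    by (rule adjacent_distinct[of _ _ v5]) (use Q in \<open>simp_all only: finite_simps\<close>)
  moreover have "v9 \<noteq> v5 \<and> A v9 v5 \<and> A v5 v9"
    by (rule adjacent_distinct[of _ _ v1]) (use Q in \<open>simp_all only: finite_simps\<close>)
  ultimately show "\<exists>v \<in> set ?us. v \<noteq> u \<and> A u v" if "u \<in> set ?us" for u
    using that by auto
qed simp

section \<open>Extremal choice and clique covers for four consecutive neighbours\<close>

lemma nb_in_V: "A x v \<Longrightarrow> v \<in> V \<Longrightarrow> x \<in> V"
  using in_V[of x v] by blast

text \<open>Two candidates for the position of \<open>v5\<close> have nested neighbourhoods:
  \<open>p\<close> and \<open>q\<close> would witness that neither contains the other. The next
  lemma does the same for \<open>v6\<close>.\<close>

lemma quad_exchange_5: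
  assumes "hole6_quad v1 v2 v3 v4 v5 v6 v7" "hole6_quad v1 v2 v3 v4 y v6 v7" "A p v5"
    "\<not> A p y" "A q y" "\<not> A q v5" "p \<in> V" "q \<in> V"
  shows "False"
  using assms no_hole4[of p v2 v1 v6] no_hole4[of p v3 v4 v5] no_hole4[of v1 q y v6]
    no_hole4[of v1 v6 q v2] no_hole4[of v4 p v2 q] no_hole4[of v4 y q v7] no_hole4[of v5 p v7 v4]
    no_hole4[of v5 v6 q v4] no_hole4[of v5 v6 y v4] no_hole4[of v6 v5 p v1] no_hole4[of y q p v5]
    no_hole4[of y q v3 v4] no_hole4[of y v6 p v4] no_path6[of p v4 y v6 v1 v2]
    no_path6[of q v4 v5 v6 v1 v2] no_path6[of v2 v7 v4 v5 v6 q] no_path6[of v2 v7 v4 y v6 p]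
    no_path6[of v3 v7 v1 q y v5] no_path6[of y v5 p v1 v7 v3]
    hole5_dominating[of v1 v7 v4 v5 v6 q] hole5_dominating[of v6 y v4 v7 v1 p]
  by (simp_all (no_asm_use) only: finite_simps) satx?

lemma quad_exchange_6:
  assumes "hole6_quad v1 v2 v3 v4 v5 v6 v7" "hole6_quad v1 v2 v3 v4 v5 y v7" "A p v6"
    "\<not> A p y" "A q y" "\<not> A q v6"
  shows "False"
  using assms no_hole4[of p v1 y v5] no_hole4[of q v1 p v3] no_hole4[of q y v6 p]
    no_hole4[of v1 v6 v5 q] no_hole4[of v1 y q v7] no_hole4[of v3 v4 v5 q] no_hole4[of v5 p v3 v4]
    no_hole4[of v5 v4 q y] no_hole4[of v5 v6 p v4] no_hole4[of v5 y v1 v6] no_hole4[of v6 p v2 v1]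
    no_hole4[of v6 p v7 v1] no_hole4[of y v1 v2 q] no_path6[of p v1 y v5 v4 v3]
    no_path6[of p v6 v5 v4 v7 v2] no_path6[of q v5 v6 v1 v2 v3] no_path6[of q y v5 v4 v7 v2]
    no_path6[of v2 v7 v4 p v6 y] no_path6[of v3 v4 v5 v6 v1 q] no_path6[of v4 v3 v2 v1 v6 p]
    no_path6[of v6 y q v4 v7 v2]
  by (simp_all (no_asm_use) only: finite_simps) satx?

text \<open>The common neighbours of \<open>v5\<close> and \<open>v6\<close> can fail to be a clique
  only through vertices like \<open>v8\<close> of \<open>quad3\<close>, and by the following variant
  only through vertices like \<open>v9\<close>. Both kinds together would complete
  \<open>quad3\<close>, so one of the two lemmas always applies.\<close>

lemma quad_common_56:
  assumes "hole6_quad v1 v2 v3 v4 v5 v6 v7" "sees y [v5, v6]" "sees z [v5, v6]"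
    "\<not> (sees y [v3, v4, v5, v6] \<and> misses y [v1, v2, v7])"
    "\<not> (sees z [v3, v4, v5, v6] \<and> misses z [v1, v2, v7])"
  shows "A y z"
  using assms no_hole4[of v2 y v6 v1] no_hole4[of v3 v4 v5 z] no_hole4[of v4 v7 z v5]
    no_hole4[of v4 y v6 z] no_hole4[of v5 y v3 v4] no_hole4[of v6 y v7 v1] no_hole4[of v7 v4 v5 y]
    no_hole4[of v7 z v6 v1] no_hole4[of y v5 z v1] no_hole4[of z v6 v1 v2]
    no_path6[of v1 v2 v3 v4 v5 z] no_path6[of v3 v7 v1 z v5 y] no_path6[of y v5 v4 v3 v2 v1]
    no_path6[of z v5 y v1 v7 v3]
  by (simp_all (no_asm_use) only: finite_simps) satx?

lemma quad_common_56_alt: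
  assumes "hole6_quad v1 v2 v3 v4 v5 v6 v7" "sees y [v5, v6]" "sees z [v5, v6]"
    "\<not> (sees y [v1, v2, v5, v6] \<and> misses y [v3, v4, v7])"
    "\<not> (sees z [v1, v2, v5, v6] \<and> misses z [v3, v4, v7])"
  shows "A y z"
  using assms no_hole4[of v1 v6 y v2] no_hole4[of v1 v7 y v6] no_hole4[of v4 v3 y v5]
    no_hole4[of v5 z v3 v4] no_hole4[of v6 v1 v2 z] no_hole4[of v6 y v4 z] no_hole4[of v7 v4 v5 z]
    no_hole4[of y v5 v4 v7] no_hole4[of y v5 z v1] no_hole4[of z v6 v1 v7]
    no_path6[of v1 v2 v3 v4 v5 y] no_path6[of v2 v7 v4 z v6 y] no_path6[of z v6 v1 v2 v3 v4]
    no_path6[of z v6 y v4 v7 v2]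
  by (simp_all (no_asm_use) only: finite_simps) satx?

lemma quad_nb_5:
  assumes "hole6_quad v1 v2 v3 v4 v5 v6 v7" "A y v5"
  shows "A y v4 \<or> A y v6"
  using assms no_hole4[of v1 y v5 v6] no_hole4[of v4 v7 y v5] no_hole4[of y v3 v4 v5]
    no_path6[of y v5 v6 v1 v7 v3]
  by (simp_all (no_asm_use) only: finite_simps) satx?

lemma quad_nb_6:
  assumes "hole6_quad v1 v2 v3 v4 v5 v6 v7" "A y v6"
  shows "A y v5 \<or> A y v1"
  using assms no_hole4[of v4 y v6 v5] no_hole4[of v6 v1 v2 y] no_hole4[of y v7 v1 v6]
    no_path6[of y v6 v5 v4 v7 v2]
  by (simp_all (no_asm_use) only: finite_simps) satx?

lemma quad_nb_56:
  assumes "hole6_quad v1 v2 v3 v4 v5 v6 v7" "A y v5" "A y v6"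
  shows "A y v4 \<or> A y v1"
  using assms no_hole4[of v2 y v6 v1] no_hole4[of v4 v5 y v3] no_path6[of y v6 v1 v2 v3 v4]
  by (simp_all (no_asm_use) only: finite_simps) satx?

text \<open>Minimality of \<open>v5\<close> enters when \<open>y\<close> or \<open>z\<close> can
  itself take the position of \<open>v5\<close>: then it sees all neighbours of \<open>v5\<close>,
  in particular the other one.\<close>

lemma quad_common_45:
  assumes "hole6_quad v1 v2 v3 v4 v5 v6 v7" "sees y [v4, v5]" "sees z [v4, v5]"
    "\<not> (sees y [v3, v4, v5] \<and> misses y [v1, v2, v6, v7])"
    "\<not> (sees z [v3, v4, v5] \<and> misses z [v1, v2, v6, v7])"
    and min5: "\<And>p q. hole6_quad v1 v2 v3 v4 p v6 v7 \<Longrightarrow> A q v5 \<Longrightarrow> A q p"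
  shows "A y z"
  using assms(1-5) min5[of y z] min5[of z y] no_hole4[of v1 v6 v5 z] no_hole4[of v1 y v4 v7]
    no_hole4[of v2 v3 v4 z] no_hole4[of v4 y v2 v3] no_hole4[of v4 y v2 v7]
    no_hole4[of v4 z v2 v7] no_hole4[of v5 v6 v1 y] no_hole4[of v6 y v4 z] no_hole4[of y v5 z v3]
    no_hole4[of z v1 v7 v4] no_hole4[of z v7 y v5] no_path6[of v3 v2 v1 v6 v5 y]
    no_path6[of z v5 v6 v1 v2 v3]
  by (simp_all (no_asm_use) only: finite_simps) satx?

lemma quad_common_16_not_4:
  assumes "hole6_quad v1 v2 v3 v4 v5 v6 v7" "sees y [v1, v6]" "sees z [v1, v6]" "\<not> A y v4"
    "\<not> A z v4"
    and min6: "\<And>p q. hole6_quad v1 v2 v3 v4 v5 p v7 \<Longrightarrow> A q v6 \<Longrightarrow> A q p"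
  shows "A y z"
  using assms(1-5) min6[of y z] min6[of z y] no_hole4[of v2 v3 z v1] no_hole4[of v4 v5 y v7]
    no_hole4[of v5 z v7 v4] no_hole4[of y v3 v2 v1] no_hole4[of z v6 y v2]
    no_path6[of y v1 v2 v3 v4 v5] no_path6[of z v6 v5 v4 v3 v2]
  by (simp_all (no_asm_use) only: finite_simps) satx?

lemma quad_common_45_not_1:
  assumes "hole6_quad v1 v2 v3 v4 v5 v6 v7" "sees y [v4, v5]" "sees z [v4, v5]" "\<not> A y v1"
    "\<not> A z v1"
    and min5: "\<And>p q. hole6_quad v1 v2 v3 v4 p v6 v7 \<Longrightarrow> A q v5 \<Longrightarrow> A q p"
  shows "A y z"
  using assms(1-5) min5[of y z] min5[of z y] no_hole4[of v1 v6 z v7] no_hole4[of v3 v2 z v4]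
    no_hole4[of y v2 v3 v4] no_hole4[of y v7 v1 v6] no_hole4[of z v5 y v3]
    no_path6[of y v5 v6 v1 v2 v3] no_path6[of z v4 v3 v2 v1 v6]
  by (simp_all (no_asm_use) only: finite_simps) satx?

lemma quad_common_16:
  assumes "hole6_quad v1 v2 v3 v4 v5 v6 v7" "sees y [v1, v6]" "sees z [v1, v6]"
    "\<not> (sees y [v1, v2, v6] \<and> misses y [v3, v4, v5, v7])"
    "\<not> (sees z [v1, v2, v6] \<and> misses z [v3, v4, v5, v7])"
    and min6: "\<And>p q. hole6_quad v1 v2 v3 v4 v5 p v7 \<Longrightarrow> A q v6 \<Longrightarrow> A q p"
  shows "A y z"
  using assms(1-5) min6[of y z] min6[of z y] no_hole4[of v1 y v3 v2] no_hole4[of v1 z v4 v7]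
    no_hole4[of v3 v7 v1 y] no_hole4[of v3 z v1 v2] no_hole4[of v4 y v1 v7]
    no_hole4[of v4 y v6 v5] no_hole4[of v5 z v1 y] no_hole4[of v6 y v7 z] no_hole4[of v7 v3 z v1]
    no_hole4[of y v2 z v6] no_hole4[of z v6 v5 v4] no_path6[of v5 v4 v3 v2 v1 y]
    no_path6[of z v6 v5 v4 v3 v2]
  by (simp_all (no_asm_use) only: finite_simps) satx?

text \<open>If \<open>y\<close> and \<open>z\<close> are adjacent, they form a \<open>C4\<close>
  with \<open>v5 v6\<close>; if not, \<open>v7 v3 y v5 v6 z\<close> is an induced
  \<open>P6\<close>.\<close>

lemma quad_types_exclusive:
  assumes "hole6_quad v1 v2 v3 v4 v5 v6 v7" "sees y [v3, v4, v5] \<and> misses y [v1, v2, v6, v7]"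
    "sees z [v1, v2, v6] \<and> misses z [v3, v4, v5, v7]"
  shows "False"
  using assms no_hole4[of v6 z y v5] no_path6[of v7 v3 y v5 v6 z]
  by (simp_all (no_asm_use) only: finite_simps) satx?

lemma quad_nb_46:
  assumes "hole6_quad v1 v2 v3 v4 v5 v6 v7" "A y v4" "A y v6"
  shows "A y v5"
  using assms no_hole4[of v5 v6 y v4]
  by (simp_all (no_asm_use) only: finite_simps) satx?

lemma quad_nb_15:
  assumes "hole6_quad v1 v2 v3 v4 v5 v6 v7" "A y v1" "A y v5"
  shows "A y v6"
  using assms no_hole4[of v5 y v1 v6]
  by (simp_all (no_asm_use) only: finite_simps) satx?

text \<open>Choose \<open>v5\<close> and \<open>v6\<close>, the hole vertices missed by
  \<open>v7\<close>, with minimum degree sum over all such configurations. Nestedness then turns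
  comparison of degrees into containment of neighbourhoods.\<close>

lemma quad_minimal:
  assumes "hole6_quad a1 a2 a3 a4 a5 a6 a7"
  obtains v1 v2 v3 v4 v5 v6 v7 where "hole6_quad v1 v2 v3 v4 v5 v6 v7"
    "\<And>p q. hole6_quad v1 v2 v3 v4 p v6 v7 \<Longrightarrow> A q v5 \<Longrightarrow> A q p"
    "\<And>p q. hole6_quad v1 v2 v3 v4 v5 p v7 \<Longrightarrow> A q v6 \<Longrightarrow> A q p"
proof -
  let ?P = "\<lambda>(v1, v2, v3, v4, v5, v6, v7). hole6_quad v1 v2 v3 v4 v5 v6 v7"
  let ?m = "\<lambda>(v1, v2, v3, v4, v5, v6, v7). card (nb v5) + card (nb v6)"
  have "\<exists>x. ?P x \<and> (\<forall>y. ?P y \<longrightarrow> ?m x \<le> ?m y)"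
    by (rule ex_has_least_nat[of ?P "(a1, a2, a3, a4, a5, a6, a7)"]) (use assms in simp)
  then obtain x where x: "?P x" "\<forall>y. ?P y \<longrightarrow> ?m x \<le> ?m y" by blast
  obtain v1 v2 v3 v4 v5 v6 v7 where eq: "x = (v1, v2, v3, v4, v5, v6, v7)" by (cases x)
  have F: "hole6_quad v1 v2 v3 v4 v5 v6 v7" using x(1) by (simp add: eq)
  have min: "card (nb v5) + card (nb v6) \<le> card (nb u5) + card (nb u6)"
    if "hole6_quad u1 u2 u3 u4 u5 u6 u7" for u1 u2 u3 u4 u5 u6 u7
    using x(2)[rule_format, of "(u1, u2, u3, u4, u5, u6, u7)"] that by (simp add: eq)
  have "hole6 v1 v2 v3 v4 v5 v6" using F by (simp add: hole6_quad_def)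
  then have V: "v5 \<in> V" "v6 \<in> V" using hole6_in_V by auto
  show thesis
  proof (rule that[OF F])
    fix p q assume p: "hole6_quad v1 v2 v3 v4 p v6 v7" and q: "A q v5"
    show "A q p"
    proof (rule ccontr)
      assume n: "\<not> A q p"
      have "card (nb v5) \<le> card (nb p)" using min[OF p] by simp
      from nb_exchange[OF this nb_in_V[OF q V(1)] q n]
      show False using quad_exchange_5[OF F p q n] nb_in_V[OF q V(1)] by blast
    qed
  next
    fix p q assume p: "hole6_quad v1 v2 v3 v4 v5 p v7" and q: "A q v6"
    show "A q p"
    proof (rule ccontr)
      assume n: "\<not> A q p"
      have "card (nb v6) \<le> card (nb p)" using min[OF p] by simp
      from nb_exchange[OF this nb_in_V[OF q V(2)] q n]
      show False using quad_exchange_6[OF F p q n] by blast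
    qed
  qed
qed

lemma no_hole6_quad: "\<not> hole6_quad a1 a2 a3 a4 a5 a6 a7"
proof
  assume "hole6_quad a1 a2 a3 a4 a5 a6 a7"
  then obtain v1 v2 v3 v4 v5 v6 v7 where F: "hole6_quad v1 v2 v3 v4 v5 v6 v7"
    and min5: "\<And>p q. hole6_quad v1 v2 v3 v4 p v6 v7 \<Longrightarrow> A q v5 \<Longrightarrow> A q p"
    and min6: "\<And>p q. hole6_quad v1 v2 v3 v4 v5 p v7 \<Longrightarrow> A q v6 \<Longrightarrow> A q p"
    using quad_minimal by metis
  have "hole6 v1 v2 v3 v4 v5 v6" using F by (simp add: hole6_quad_def)
  moreover have "A v7 v1" "A v7 v3" "\<not> A v1 v3" using F by (simp_all only: finite_simps)
  ultimately have V: "{v1, v2, v3, v4, v5, v6, v7} \<subseteq> V"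
    using hole6_in_V[of v1 v2 v3 v4 v5 v6] in_V2[of v7 v1 v3] by simp
  then have mem: "v5 \<in> V" "v6 \<in> V" by simp_all
  let ?t8 = "\<lambda>y. sees y [v3, v4, v5, v6] \<and> misses y [v1, v2, v7]"
  let ?t9 = "\<lambda>y. sees y [v1, v2, v5, v6] \<and> misses y [v3, v4, v7]"
  let ?t4 = "\<lambda>y. sees y [v3, v4, v5] \<and> misses y [v1, v2, v6, v7]"
  let ?t1 = "\<lambda>y. sees y [v1, v2, v6] \<and> misses y [v3, v4, v5, v7]"
  have "False" if "?t8 p" "?t9 q" "p \<in> V" "q \<in> V" for p q
    using no_quad3[OF quad_extends_to_quad3[OF F that(1,2)]] V that(3,4) by simp
  then have c56: "A y z" if "y \<in> V" "z \<in> V" "sees y [v5, v6]" "sees z [v5, v6]" for y z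
    using quad_common_56[OF F that(3,4)] quad_common_56_alt[OF F that(3,4)] that(1,2) by blast
  consider "\<And>y. y \<in> V \<Longrightarrow> \<not> ?t4 y" | "\<And>y. y \<in> V \<Longrightarrow> \<not> ?t1 y"
    using quad_types_exclusive[OF F] by blast
  then show False
  proof cases
    case 1
    \<comment> \<open>Restricting the third set to nonneighbours of \<open>v4\<close> makes it a
      clique whether or not vertices of type \<open>?t1\<close> exist. The cover survives: by
      \<open>quad_nb_46\<close> a neighbour of \<open>v4\<close> and \<open>v6\<close> sees
      \<open>v5\<close> too.\<close>
    show False
    proof (rule no_clique_cover[OF mem, of "\<lambda>y. sees y [v4, v5]" "\<lambda>y. sees y [v5, v6]"
          "\<lambda>y. sees y [v1, v6] \<and> \<not> A y v4"])
      show "A y z" if "y \<in> V" "z \<in> V" "sees y [v4, v5]" "sees z [v4, v5]" for y z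
        using quad_common_45[OF F that(3,4) 1[OF that(1)] 1[OF that(2)] min5] .
      show "A y z" if "y \<in> V" "z \<in> V" "sees y [v5, v6]" "sees z [v5, v6]" for y z
        using c56[OF that] .
      show "A y z" if "y \<in> V" "z \<in> V" "sees y [v1, v6] \<and> \<not> A y v4" "sees z [v1, v6] \<and> \<not> A z v4" for y z
        using quad_common_16_not_4[OF F _ _ _ _ min6] that by blast
      fix y
      show "sees y [v4, v5] \<or> sees y [v5, v6] \<or> sees y [v1, v6] \<and> \<not> A y v4" if "A y v5"
        using quad_nb_5[OF F that] that by (auto simp: sees_def)
      show "sees y [v4, v5] \<or> sees y [v5, v6] \<or> sees y [v1, v6] \<and> \<not> A y v4" if "A y v6"
        using quad_nb_6[OF F that] quad_nb_46[OF F _ that] that by (auto simp: sees_def)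
      show "sees y [v4, v5] \<and> (sees y [v5, v6] \<or> sees y [v1, v6] \<and> \<not> A y v4) \<or>
          sees y [v5, v6] \<and> (sees y [v1, v6] \<and> \<not> A y v4)" if "A y v5" "A y v6"
        using quad_nb_56[OF F that] that by (auto simp: sees_def)
    qed
  next
    case 2
    \<comment> \<open>The mirror image: now the set for \<open>v4 v5\<close> omits neighbours of
      \<open>v1\<close>, which by \<open>quad_nb_15\<close> also see \<open>v6\<close> and remain
      covered.\<close>
    show False
    proof (rule no_clique_cover[OF mem, of "\<lambda>y. sees y [v4, v5] \<and> \<not> A y v1" "\<lambda>y. sees y [v5, v6]"
          "\<lambda>y. sees y [v1, v6]"])
      show "A y z" if "y \<in> V" "z \<in> V" "sees y [v4, v5] \<and> \<not> A y v1" "sees z [v4, v5] \<and> \<not> A z v1" for y z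
        using quad_common_45_not_1[OF F _ _ _ _ min5] that by blast
      show "A y z" if "y \<in> V" "z \<in> V" "sees y [v5, v6]" "sees z [v5, v6]" for y z
        using c56[OF that] .
      show "A y z" if "y \<in> V" "z \<in> V" "sees y [v1, v6]" "sees z [v1, v6]" for y z
        using quad_common_16[OF F that(3,4) 2[OF that(1)] 2[OF that(2)] min6] .
      fix y
      show "sees y [v4, v5] \<and> \<not> A y v1 \<or> sees y [v5, v6] \<or> sees y [v1, v6]" if "A y v5"
        using quad_nb_5[OF F that] quad_nb_15[OF F _ that] that by (auto simp: sees_def)
      show "sees y [v4, v5] \<and> \<not> A y v1 \<or> sees y [v5, v6] \<or> sees y [v1, v6]" if "A y v6"
        using quad_nb_6[OF F that] that by (auto simp: sees_def)
      show "(sees y [v4, v5] \<and> \<not> A y v1) \<and> (sees y [v5, v6] \<or> sees y [v1, v6]) \<or>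
          sees y [v5, v6] \<and> sees y [v1, v6]" if "A y v5" "A y v6"
        using quad_nb_56[OF F that] that by (auto simp: sees_def)
    qed
  qed
qed

subsection \<open>Other \<open>6\<close>-holes\<close>

lemma hole6_common_12:
  assumes "hole6 v1 v2 v3 v4 v5 v6" "sees y [v1, v2]" "sees z [v1, v2]"
  shows "A y z"
  using assms no_hole4[of v2 v3 v4 z] no_hole4[of v5 v6 v1 y] no_hole4[of v6 v5 z v1]
    no_hole4[of y v3 z v1] no_hole4[of y v4 v3 v2] no_hole4[of z v6 y v2]
    no_path6[of v4 v5 v6 y v2 z] no_path6[of v5 v4 v3 y v1 z] no_path6[of v6 v5 v4 v3 v2 z]
    no_path6[of y v2 v3 v4 v5 v6] no_hole6_quad[of v2 v1 v6 v5 v4 v3 y]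
    no_hole6_quad[of v2 v1 v6 v5 v4 v3 z] no_hole6_quad[of v4 v3 v2 v1 v6 v5 y]
    no_hole6_quad[of v4 v3 v2 v1 v6 v5 z]
  by (simp_all (no_asm_use) only: finite_simps) satx?

lemma hole6_common_23:
  assumes "hole6 v1 v2 v3 v4 v5 v6" "sees y [v2, v3]" "sees z [v2, v3]"
  shows "A y z"
  using assms no_hole4[of v1 v6 y v2] no_hole4[of v1 v6 z v2] no_hole4[of y v2 z v4]
    no_hole4[of y v5 v4 v3] no_hole4[of z v1 y v3] no_hole4[of z v5 v4 v3]
    no_path6[of v4 v5 v6 v1 v2 z] no_path6[of v5 v6 v1 y v3 z] no_path6[of v6 v5 v4 y v2 z]
    no_path6[of y v3 v4 v5 v6 v1] no_hole6_quad[of v2 v3 v4 v5 v6 v1 y]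
    no_hole6_quad[of v2 v3 v4 v5 v6 v1 z] no_hole6_quad[of v6 v1 v2 v3 v4 v5 y]
    no_hole6_quad[of v6 v1 v2 v3 v4 v5 z]
  by (simp_all (no_asm_use) only: finite_simps) satx?

lemma hole6_common_34:
  assumes "hole6 v1 v2 v3 v4 v5 v6" "sees y [v3, v4]" "sees z [v3, v4]"
  shows "A y z"
  using assms no_hole4[of v2 v1 z v3] no_hole4[of v3 y v1 v2] no_hole4[of v4 z v6 v5]
    no_hole4[of v6 y v4 v5] no_hole4[of y v2 z v4] no_hole4[of z v5 y v3]
    no_path6[of v5 v6 v1 v2 v3 z] no_path6[of v6 v1 v2 z v4 y] no_path6[of y v3 v2 v1 v6 v5]
    no_path6[of z v4 y v2 v1 v6] no_hole6_quad[of v1 v2 v3 v4 v5 v6 y]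
    no_hole6_quad[of v3 v4 v5 v6 v1 v2 y] no_hole6_quad[of v3 v4 v5 v6 v1 v2 z]
    no_hole6_quad[of v4 v3 v2 v1 v6 v5 z]
  by (simp_all (no_asm_use) only: finite_simps) satx?

lemma hole6_nb_2:
  assumes "hole6 v1 v2 v3 v4 v5 v6" "A y v2"
  shows "A y v1 \<or> A y v3"
  using assms no_hole4[of v2 y v6 v1] no_hole4[of v3 v4 y v2] no_path6[of y v2 v3 v4 v5 v6]
    no_hole6_pair[of v2 v1 v6 v5 v4 v3 y]
  by (simp_all (no_asm_use) only: finite_simps) satx?

lemma hole6_nb_3:
  assumes "hole6 v1 v2 v3 v4 v5 v6" "A y v3"
  shows "A y v2 \<or> A y v4"
  using assms no_hole4[of v2 v3 y v1] no_hole4[of v4 v5 y v3] no_path6[of y v3 v4 v5 v6 v1]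
    no_hole6_pair[of v3 v2 v1 v6 v5 v4 y]
  by (simp_all (no_asm_use) only: finite_simps) satx?

lemma hole6_nb_23:
  assumes "hole6 v1 v2 v3 v4 v5 v6" "A y v2" "A y v3"
  shows "A y v1 \<or> A y v4"
  using assms no_hole4[of v2 y v6 v1] no_hole4[of v4 v5 y v3] no_path6[of y v3 v4 v5 v6 v1]
  by (simp_all (no_asm_use) only: finite_simps) satx?

text \<open>Once pairs and quads are excluded, the common neighbours of each hole edge form a
  clique, and every neighbour of a hole vertex sees one of the two adjacent hole vertices. This
  gives a cover at two consecutive vertices.\<close>

lemma no_hole6: "\<not> hole6 v1 v2 v3 v4 v5 v6"
proof
  assume C: "hole6 v1 v2 v3 v4 v5 v6"
  have V: "v2 \<in> V" "v3 \<in> V" using hole6_in_V[OF C] by auto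
  show False
  proof (rule no_clique_cover[OF V, of "\<lambda>y. sees y [v1, v2]" "\<lambda>y. sees y [v2, v3]"
        "\<lambda>y. sees y [v3, v4]"])
    show "A y z" if "sees y [v1, v2]" "sees z [v1, v2]" for y z
      using hole6_common_12[OF C that] .
    show "A y z" if "sees y [v2, v3]" "sees z [v2, v3]" for y z
      using hole6_common_23[OF C that] .
    show "A y z" if "sees y [v3, v4]" "sees z [v3, v4]" for y z
      using hole6_common_34[OF C that] .
    fix y
    show "sees y [v1, v2] \<or> sees y [v2, v3] \<or> sees y [v3, v4]" if "A y v2"
      using hole6_nb_2[OF C that] that by (auto simp: sees_def)
    show "sees y [v1, v2] \<or> sees y [v2, v3] \<or> sees y [v3, v4]" if "A y v3"
      using hole6_nb_3[OF C that] that by (auto simp: sees_def)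
    show "sees y [v1, v2] \<and> (sees y [v2, v3] \<or> sees y [v3, v4]) \<or> sees y [v2, v3] \<and> sees y [v3, v4]"
      if "A y v2" "A y v3"
      using hole6_nb_23[OF C that] that by (auto simp: sees_def)
  qed
qed

subsection \<open>Pyramids\<close>

text \<open>If the common neighbours of \<open>x\<close> and \<open>p\<close> are not a clique, one
  of them sees nothing of \<open>q\<close>, \<open>r\<close> and \<open>a\<close>. Such a vertex
  marks the leg of \<open>p\<close> as bad.\<close>

lemma pyramid_common_apex:
  assumes "pyramid x p q r a b c" "sees y [x, p]" "sees z [x, p]" "\<not> A y z" "q \<in> V"
    "r \<in> V"
  shows "misses y [q, r, a] \<or> misses z [q, r, a]"
  using assms no_hole4[of a p z b] no_hole4[of c y p a] no_hole4[of p a c z]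
    no_hole4[of p y b a] no_hole4[of q y p z] no_hole4[of r x z c] no_hole4[of x q b z]
    no_hole4[of x r c y] no_hole4[of x z a y] no_hole4[of y b q x] no_hole4[of z r y p]
    no_path6[of b c r y p z] no_path6[of c b q z p y] no_path6[of q b c r z p]
    no_path6[of q z p a c r] hole5_dominating[of a c r y p q] hole5_dominating[of q b a p y r]
  by (simp_all (no_asm_use) only: finite_simps) satx?

text \<open>At most one leg is bad: such vertices on two legs create a \<open>C4\<close>, a
  \<open>P6\<close> or a 6-hole.\<close>

lemma pyramid_apex_exclusive:
  assumes "pyramid x p q r a b c" "sees y [x, p]" "misses y [q, r, a]" "sees z [x, q]"
    "misses z [r, p, b]"
  shows "False"
  using assms no_hole4[of p y b a] no_hole4[of z a p x] no_path6[of z q b a p y]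
    no_hole6[of z q b a p y]
  by (simp_all (no_asm_use) only: finite_simps) satx?

lemma pyramid_far_pq:
  assumes "pyramid x p q r a b c" "A y p" "\<not> A y x" "A z q" "\<not> A z x"
  shows "A y z"
  using assms no_hole4[of q x p y] no_hole4[of x p y r] no_hole4[of x p z q]
    no_hole4[of x r z q] no_path6[of a c r x q z] no_path6[of c b q x p y]
    no_hole6[of c r x p y b] no_hole6[of x r c a z q] no_hole6[of y c z q x p]
  by (simp_all (no_asm_use) only: finite_simps) satx?

lemma pyramid_far_pp:
  assumes "pyramid x p q r a b c" "A y p" "\<not> A y x" "A z p" "\<not> A z x"
  shows "A y z"
  using assms no_hole4[of c y p z] no_hole4[of p y r x] no_hole4[of r z p x]
    no_hole4[of x p z q] no_path6[of c b q x p z] no_path6[of y p x r c b]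
    no_hole6[of b z p x r c] no_hole6[of r x p y b c]
  by (simp_all (no_asm_use) only: finite_simps) satx?

lemma pyramid_nb_pq:
  assumes "pyramid x p q r a b c" "A y p" "A y q"
  shows "A y x"
  using assms no_hole4[of y q x p]
  by (simp_all (no_asm_use) only: finite_simps) satx?

text \<open>Two of the three legs are good. For them the cover consists of the common neighbours of
  \<open>x\<close> with each leg and of all neighbours of the two legs that miss
  \<open>x\<close>.\<close>

lemma no_pyramid: "\<not> pyramid x p q r a b c"
proof
  assume P: "pyramid x p q r a b c"
  have "A x p" "A x q" "\<not> A p q" "A r x" "A r c" "\<not> A x c"
    using P by (simp_all only: finite_simps)
  then have V: "p \<in> V" "q \<in> V" "r \<in> V"
    using in_V2[of x p q] in_V2[of x q p] in_V2[of r c x] by (simp_all add: sym)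
  define good where "good p \<longleftrightarrow> (\<forall>y \<in> V. \<forall>z \<in> V. sees y [x, p] \<and> sees z [x, p] \<longrightarrow> A y z)" for p
  have cover: False if P: "pyramid x p q r a b c" and good: "good p" "good q"
    and V: "p \<in> V" "q \<in> V" for p q r a b c
  proof -
    have P': "pyramid x q p r b a c" using P by (simp only: finite_simps)
    show False
    proof (rule no_clique_cover[OF V, of "\<lambda>y. sees y [x, p]" "\<lambda>y. sees y [x, q]"
          "\<lambda>y. \<not> A y x \<and> (A y p \<or> A y q)"])
      show "A y z" if "y \<in> V" "z \<in> V" "sees y [x, p]" "sees z [x, p]" for y z
        using good(1) that by (simp add: good_def)
      show "A y z" if "y \<in> V" "z \<in> V" "sees y [x, q]" "sees z [x, q]" for y z
        using good(2) that by (simp add: good_def)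
      show "A y z" if "\<not> A y x \<and> (A y p \<or> A y q)" "\<not> A z x \<and> (A z p \<or> A z q)" for y z
        using pyramid_far_pp[OF P] pyramid_far_pq[OF P] pyramid_far_pp[OF P']
          pyramid_far_pq[OF P'] that by blast
      fix y
      show "sees y [x, p] \<or> sees y [x, q] \<or> \<not> A y x \<and> (A y p \<or> A y q)" if "A y p"
        using that by (auto simp: sees_def)
      show "sees y [x, p] \<or> sees y [x, q] \<or> \<not> A y x \<and> (A y p \<or> A y q)" if "A y q"
        using that by (auto simp: sees_def)
      show "sees y [x, p] \<and> (sees y [x, q] \<or> \<not> A y x \<and> (A y p \<or> A y q)) \<or>
          sees y [x, q] \<and> (\<not> A y x \<and> (A y p \<or> A y q))" if "A y p" "A y q"
        using pyramid_nb_pq[OF P that] that by (auto simp: sees_def)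
    qed
  qed
  have bad: "\<exists>y. sees y [x, p] \<and> misses y [q, r, a]"
    if "pyramid x p q r a b c" "\<not> good p" "q \<in> V" "r \<in> V" for p q r a b c
    using that(2) pyramid_common_apex[OF that(1) _ _ _ that(3,4)] unfolding good_def by blast
  have excl: "good p \<or> good q"
    if P: "pyramid x p q r a b c" and V: "p \<in> V" "q \<in> V" "r \<in> V" for p q r a b c
  proof (rule ccontr)
    assume n: "\<not> (good p \<or> good q)"
    have P': "pyramid x q r p b c a" using P by (simp only: finite_simps)
    show False
      using bad[OF P _ V(2,3)] bad[OF P' _ V(3,1)] n pyramid_apex_exclusive[OF P] by blast
  qed
  have P1: "pyramid x q r p b c a" and P2: "pyramid x p r q a c b"
    using P by (simp_all only: finite_simps)
  show False
    using excl[OF P V] excl[OF P1 V(2,3,1)] excl[OF P2 V(1,3,2)] cover[OF P _ _ V(1,2)]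
      cover[OF P1 _ _ V(2,3)] cover[OF P2 _ _ V(1,3)] by blast
qed

subsection \<open>\<open>5\<close>-holes\<close>

text \<open>A \<open>5\<close>-hole of maximum degree sum leaves no vertex with fewer than three neighbours on it.\<close>

definition heavy_hole5 :: "'a \<Rightarrow> 'a \<Rightarrow> 'a \<Rightarrow> 'a \<Rightarrow> 'a \<Rightarrow> bool" where
  "heavy_hole5 a b c d e \<longleftrightarrow> hole5 a b c d e \<and>
    (\<forall>a' b' c' d' e'. hole5 a' b' c' d' e' \<longrightarrow>
      card (nb a') + card (nb b') + card (nb c') + card (nb d') + card (nb e') \<le>
      card (nb a) + card (nb b) + card (nb c) + card (nb d) + card (nb e))"

lemma heavy_hole5_exists:
  assumes "hole5 a b c d e"
  shows "\<exists>a b c d e. heavy_hole5 a b c d e"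
proof -
  let ?P = "\<lambda>(a, b, c, d, e). hole5 a b c d e"
  let ?m = "\<lambda>(a, b, c, d, e). card (nb a) + card (nb b) + card (nb c) + card (nb d) + card (nb e)"
  have le: "card (nb v) \<le> card V" for v using nb_subset fin by (rule card_mono[rotated])
  have "?m (a, b, c, d, e) \<le> 5 * card V" for a b c d e
    using le[of a] le[of b] le[of c] le[of d] le[of e] by simp
  then have "\<forall>x. ?P x \<longrightarrow> ?m x < Suc (5 * card V)" by (auto simp: less_Suc_eq_le)
  then obtain x where x: "?P x" "\<forall>y. ?P y \<longrightarrow> ?m y \<le> ?m x"
    using ex_has_greatest_nat[of ?P "(a, b, c, d, e)" ?m "Suc (5 * card V)"] assms by auto
  obtain v1 v2 v3 v4 v5 where eq: "x = (v1, v2, v3, v4, v5)" by (cases x)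
  have "?m (u1, u2, u3, u4, u5) \<le> ?m x" if "hole5 u1 u2 u3 u4 u5" for u1 u2 u3 u4 u5
    using x(2) that by blast
  then have "heavy_hole5 v1 v2 v3 v4 v5"
    using x(1) unfolding heavy_hole5_def by (simp add: eq)
  then show ?thesis by blast
qed

lemma heavy_hole5_rotate: "heavy_hole5 a b c d e \<Longrightarrow> heavy_hole5 b c d e a"
  unfolding heavy_hole5_def by (auto simp: hole5_def sees_def misses_def sym add_ac)

text \<open>Replacing \<open>v5\<close> by \<open>s\<close> cannot raise the degree sum, so a
  neighbour gained by \<open>s\<close> is paid for by one that it loses.\<close>

lemma heavy_hole5_exchange:
  assumes C: "heavy_hole5 v1 v2 v3 v4 v5" and s: "hole5 v1 v2 v3 v4 s" and "A y s" "\<not> A y v5"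
  shows "\<exists>q \<in> V. A q v5 \<and> \<not> A q s"
proof (rule nb_exchange)
  have "s \<in> V" using hole5_in_V[OF s] by simp
  then show "y \<in> V" using nb_in_V assms(3) by blast
  show "card (nb s) \<le> card (nb v5)" using C s unfolding heavy_hole5_def by fastforce
qed (use assms in auto)

section \<open>Components attached to an edge of a 5-hole\<close>

lemma hole5_nb_edge_types:
  assumes "hole5 v1 v2 v3 v4 v5" "misses y [v3, v4, v5] \<and> \<not> misses y [v1, v2]" "A y s"
    "\<not> (misses s [v3, v4, v5] \<and> \<not> misses s [v1, v2])"
    "\<not> (sees s [v3] \<and> misses s [v1, v2, v4, v5])"
    "\<not> (sees s [v5] \<and> misses s [v1, v2, v3, v4])" "s \<in> V"
  shows "(sees s [v1, v2, v5] \<and> misses s [v3, v4] \<or> sees s [v1, v2, v3] \<and> misses s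
    [v4, v5] \<or> sees s [v1, v2, v3, v4, v5]) \<or> sees s [v1, v4, v5] \<and> misses s [v2,
    v3] \<or> sees s [v2, v3, v4] \<and> misses s [v1, v5]"
  using assms no_hole4[of s v4 v3 v2] no_hole4[of s v4 v5 v1] no_hole4[of v1 s v3 v2]
    no_hole4[of v2 s v5 v1] no_hole4[of v5 s v3 v4] no_hole4[of y v1 v5 s] no_hole4[of y v2 v3 s]
    no_path6[of y s v3 v4 v5 v1] no_path6[of y s v5 v4 v3 v2]
    hole5_dominating[of v3 v4 v5 v1 v2 s] no_hole6[of s y v1 v5 v4 v3]
    no_hole6[of v1 v2 y s v4 v5] no_hole6[of v1 y s v4 v3 v2] no_hole6[of v3 v4 v5 s y v2]
    no_pyramid[of v1 v5 y v2 v4 s v3] no_pyramid[of v2 v3 y v1 v4 s v5]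
    no_pyramid[of v4 v3 s v5 v2 y v1]
  by (simp_all (no_asm_use) only: finite_simps) satx?

text \<open>Here \<open>s\<close> could replace \<open>v5\<close> on the hole. The vertex
  \<open>q\<close> provided by maximality then has one of two traces on the hole, both excluded
  where this is applied; the next lemma is the mirror image at \<open>v3\<close>.\<close>

lemma hole5_exchange_5:
  assumes "hole5 v1 v2 v3 v4 v5" "misses y [v3, v4, v5] \<and> \<not> misses y [v1, v2]" "A y s"
    "sees s [v1, v4, v5] \<and> misses s [v2, v3]" "A q v5" "\<not> A q s"
  shows "sees q [v5] \<and> misses q [v1, v2, v3, v4] \<or> sees q [v1, v5] \<and> misses q [v2,
    v3, v4]"
  using assms no_hole4[of q v4 s v1] no_hole4[of v1 v2 q v5] no_hole4[of v5 v4 v3 q]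
    no_hole4[of y s v5 q] no_path6[of q v5 s y v2 v3] no_path6[of v2 v3 q v5 s y]
    no_path6[of y s v5 q v2 v3] no_path6[of y v1 v2 v3 v4 q] no_hole6[of q v3 v2 y s v5]
    no_pyramid[of v2 q v3 y v5 v4 s]
  by (simp_all (no_asm_use) only: finite_simps) satx?

lemma hole5_exchange_3:
  assumes "hole5 v1 v2 v3 v4 v5" "misses y [v3, v4, v5] \<and> \<not> misses y [v1, v2]" "A y s"
    "sees s [v2, v3, v4] \<and> misses s [v1, v5]" "A q v3" "\<not> A q s"
  shows "sees q [v3] \<and> misses q [v1, v2, v4, v5] \<or> sees q [v2, v3] \<and> misses q [v1,
    v4, v5]"
  using assms no_hole4[of q v5 v4 v3] no_hole4[of s v3 q y] no_hole4[of s v4 q v2]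
    no_hole4[of v3 v2 v1 q] no_path6[of v1 v5 q v3 s y] no_path6[of v5 v1 q v3 s y]
    no_path6[of v5 v1 y s v3 q] no_path6[of y v2 v1 v5 v4 q] no_hole6[of y s v3 q v5 v1]
    no_pyramid[of v1 y v5 q s v4 v3]
  by (simp_all (no_asm_use) only: finite_simps) satx?

text \<open>The three path lemmas play the role of those on undominated paths: attachments that see
  both \<open>v1\<close> and \<open>v2\<close> are pairwise adjacent.\<close>

lemma hole5_edge_path1:
  assumes "hole5 v1 v2 v3 v4 v5" "misses a [v3, v4, v5] \<and> \<not> misses a [v1, v2]"
    "sees u [v1, v2, v5] \<and> misses u [v3, v4] \<or> sees u [v1, v2, v3] \<and> misses u [v4,
      v5] \<or> sees u [v1, v2, v3, v4, v5]"
    "sees v [v1, v2, v5] \<and> misses v [v3, v4] \<or> sees v [v1, v2, v3] \<and> misses v [v4,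
      v5] \<or> sees v [v1, v2, v3, v4, v5]" "A u a" "A a v" "\<not> A u v"
  shows "False"
  using assms no_hole4[of v3 u a v] no_hole4[of v5 v a u] no_hole6[of v a u v3 v4 v5]
    no_hole6[of v5 u a v v3 v4]
  by (simp_all (no_asm_use) only: finite_simps) satx?

lemma hole5_edge_path2:
  assumes "hole5 v1 v2 v3 v4 v5" "misses a [v3, v4, v5] \<and> \<not> misses a [v1, v2]"
    "misses b [v3, v4, v5] \<and> \<not> misses b [v1, v2]"
    "sees u [v1, v2, v5] \<and> misses u [v3, v4] \<or> sees u [v1, v2, v3] \<and> misses u [v4,
      v5] \<or> sees u [v1, v2, v3, v4, v5]"
    "sees v [v1, v2, v5] \<and> misses v [v3, v4] \<or> sees v [v1, v2, v3] \<and> misses v [v4,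
      v5] \<or> sees v [v1, v2, v3, v4, v5]" "sees u [a]" "misses u [b, v]" "sees a [b]"
    "misses a [v]" "sees b [v]"
  shows "False"
  using assms no_hole4[of v v2 u v5] no_path6[of b a u v3 v4 v5] no_path6[of v5 v4 v3 v b a]
  by (simp_all (no_asm_use) only: finite_simps) satx?

lemma hole5_edge_path3:
  assumes "hole5 v1 v2 v3 v4 v5" "misses a [v3, v4, v5] \<and> \<not> misses a [v1, v2]"
    "misses b [v3, v4, v5] \<and> \<not> misses b [v1, v2]"
    "misses c [v3, v4, v5] \<and> \<not> misses c [v1, v2]"
    "sees u [v1, v2, v5] \<and> misses u [v3, v4] \<or> sees u [v1, v2, v3] \<and> misses u [v4,
      v5] \<or> sees u [v1, v2, v3, v4, v5]"
    "sees v [v1, v2, v5] \<and> misses v [v3, v4] \<or> sees v [v1, v2, v3] \<and> misses v [v4,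
      v5] \<or> sees v [v1, v2, v3, v4, v5]" "sees u [a]" "misses u [b, c, v]" "sees a [b]"
    "misses a [c, v]" "sees b [c]" "misses b [v]" "sees c [v]"
  shows "False"
  using assms no_path6[of a b c v v3 v4] no_path6[of v4 v3 u a b c] no_hole6[of c v v5 u a b]
  by (simp_all (no_asm_use) only: finite_simps) satx?

lemma hole5_edge_type_excludes:
  assumes "hole5 v1 v2 v3 v4 v5" "sees b [v1, v2] \<and> misses b [v3, v4, v5]"
  shows "\<not> (sees y [v3] \<and> misses y [v1, v2, v4, v5]) \<and> \<not> (sees y [v5] \<and>
    misses y [v1, v2, v3, v4]) \<and> \<not> (sees y [v2, v3] \<and> misses y [v1, v4, v5])
    \<and> \<not> (sees y [v1, v5] \<and> misses y [v2, v3, v4])"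
  using assms no_path6[of y v3 v4 v5 v1 b] no_path6[of y v5 v4 v3 v2 b]
    no_hole6[of b v2 v3 v4 v5 y] no_hole6[of v1 v5 v4 v3 y b]
  by (simp_all (no_asm_use) only: finite_simps) satx?

lemma hole5_vertex_type_excludes:
  assumes "hole5 v1 v2 v3 v4 v5" "sees b [v1] \<and> misses b [v2, v3, v4, v5]"
  shows "\<not> (sees y [v3] \<and> misses y [v1, v2, v4, v5]) \<and> \<not> (sees y [v4] \<and>
    misses y [v1, v2, v3, v5])"
  using assms no_path6[of y v3 v4 v5 v1 b] no_path6[of y v4 v3 v2 v1 b]
    no_hole6[of b y v4 v3 v2 v1] no_hole6[of v1 b y v3 v4 v5]
  by (simp_all (no_asm_use) only: finite_simps) satx?

lemma hole5_types:
  assumes "hole5 v1 v2 v3 v4 v5" "y \<in> V"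
  shows "sees y [v1] \<and> misses y [v2, v3, v4, v5] \<or> sees y [v2] \<and> misses y [v1, v3,
    v4, v5] \<or> sees y [v3] \<and> misses y [v1, v2, v4, v5] \<or> sees y [v4] \<and> misses y
    [v1, v2, v3, v5] \<or> sees y [v5] \<and> misses y [v1, v2, v3, v4] \<or> sees y [v1, v2]
    \<and> misses y [v3, v4, v5] \<or> sees y [v2, v3] \<and> misses y [v1, v4, v5] \<or> sees y
    [v3, v4] \<and> misses y [v1, v2, v5] \<or> sees y [v4, v5] \<and> misses y [v1, v2, v3]
    \<or> sees y [v1, v5] \<and> misses y [v2, v3, v4] \<or> sees y [v1, v2, v5] \<and> misses y
    [v3, v4] \<or> sees y [v1, v2, v3] \<and> misses y [v4, v5] \<or> sees y [v2, v3, v4] \<and>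
    misses y [v1, v5] \<or> sees y [v3, v4, v5] \<and> misses y [v1, v2] \<or> sees y [v1, v4,
    v5] \<and> misses y [v2, v3] \<or> sees y [v1, v2, v3, v4, v5]"
  using assms no_hole4[of v2 v1 y v3] no_hole4[of v4 v3 v2 y] no_hole4[of v4 y v1 v5]
    no_hole4[of v5 y v3 v4] no_hole4[of y v5 v1 v2] hole5_dominating[of v5 v1 v2 v3 v4 y]
  by (simp_all (no_asm_use) only: finite_simps) satx?

lemma hole5_universal:
  assumes "hole5 v1 v2 v3 v4 v5" "sees y [v1, v2, v3, v4, v5]"
    "sees z [v1, v2, v5] \<and> misses z [v3, v4] \<or> sees z [v1, v2, v3] \<and> misses z [v4,
      v5] \<or> sees z [v2, v3, v4] \<and> misses z [v1, v5] \<or> sees z [v3, v4, v5] \<and>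
      misses z [v1, v2] \<or> sees z [v1, v4, v5] \<and> misses z [v2, v3] \<or> sees z [v1, v2,
      v3, v4, v5]"
  shows "A y z"
  using assms no_hole4[of v2 z v4 y] no_hole4[of v3 z v1 y] no_hole4[of v5 z v3 y]
    no_hole4[of y v2 z v5] no_hole4[of z v4 y v1]
  by (simp_all (no_asm_use) only: finite_simps) satx?

text \<open>The vertices whose neighbours on the hole lie in \<open>{v1, v2}\<close>, with at least
  one there, split into components. Maximality of the hole leaves only attachments that see both
  \<open>v1\<close> and \<open>v2\<close>; these form a clique cutting the component off from
  \<open>v4\<close>.\<close>

lemma hole5_attached_to_edge:
  assumes C: "heavy_hole5 v1 v2 v3 v4 v5"
    and none: "\<And>y. y \<in> V \<Longrightarrow> \<not> (sees y [v3] \<and> misses y [v1, v2, v4, v5])"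
      "\<And>y. y \<in> V \<Longrightarrow> \<not> (sees y [v5] \<and> misses y [v1, v2, v3, v4])"
      "\<And>y. y \<in> V \<Longrightarrow> \<not> (sees y [v2, v3] \<and> misses y [v1, v4, v5])"
      "\<And>y. y \<in> V \<Longrightarrow> \<not> (sees y [v1, v5] \<and> misses y [v2, v3, v4])"
    and b: "b \<in> V" "misses b [v3, v4, v5] \<and> \<not> misses b [v1, v2]"
  shows False
proof -
  have h: "hole5 v1 v2 v3 v4 v5" using C by (simp add: heavy_hole5_def)
  have V: "{v1, v2, v3, v4, v5} \<subseteq> V" by (rule hole5_in_V[OF h])
  have C': "heavy_hole5 v4 v5 v1 v2 v3"
    using C heavy_hole5_rotate by blast
  let ?T = "\<lambda>y. misses y [v3, v4, v5] \<and> \<not> misses y [v1, v2]"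
  let ?S = "\<lambda>s. (sees s [v1, v2, v5] \<and> misses s [v3, v4]) \<or>
    (sees s [v1, v2, v3] \<and> misses s [v4, v5]) \<or> sees s [v1, v2, v3, v4, v5]"
  define X where "X = {y \<in> V. ?T y}"
  have bX: "b \<in> X" using b by (simp add: X_def)
  define Y where "Y = component X b"
  have YX: "Y \<subseteq> X" using component_subset[OF bX] by (simp add: Y_def)
  have S: "?S s" if s: "s \<in> V - Y" and ex: "\<exists>y \<in> Y. A s y" for s
  proof -
    obtain y where y: "y \<in> Y" "A y s" using ex sym by blast
    then have yT: "?T y" "y \<in> V" using YX by (auto simp: X_def)
    have "s \<notin> X" using component_closed[OF bX, of y s] y s unfolding Y_def by blast
    then have sT: "\<not> ?T s" using s by (simp add: X_def)
    have sV: "s \<in> V" using s by blast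
    have "\<not> (sees s [v1, v4, v5] \<and> misses s [v2, v3])"
    proof
      assume t: "sees s [v1, v4, v5] \<and> misses s [v2, v3]"
      have "hole5 v1 v2 v3 v4 s" using h t by (simp only: finite_simps)
      moreover have "\<not> A y v5" using yT by (simp only: finite_simps)
      ultimately obtain q where "q \<in> V" "A q v5" "\<not> A q s"
        using heavy_hole5_exchange[OF C _ y(2)] by blast
      then show False using hole5_exchange_5[OF h yT(1) y(2) t] none(2,4) by blast
    qed
    moreover have "\<not> (sees s [v2, v3, v4] \<and> misses s [v1, v5])"
    proof
      assume t: "sees s [v2, v3, v4] \<and> misses s [v1, v5]"
      have "hole5 v4 v5 v1 v2 s" using h t by (simp only: finite_simps)
      moreover have "\<not> A y v3" using yT by (simp only: finite_simps)
      ultimately obtain q where "q \<in> V" "A q v3" "\<not> A q s"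
        using heavy_hole5_exchange[OF C' _ y(2)] by blast
      then show False using hole5_exchange_3[OF h yT(1) y(2) t] none(1,3) by blast
    qed
    ultimately show ?thesis
      using hole5_nb_edge_types[OF h yT(1) y(2) sT none(1)[OF sV] none(2)[OF sV] sV] by blast
  qed
  show False
  proof (rule no_clique_cutset[of Y b v4])
    show "Y \<subseteq> V" using YX by (auto simp: X_def)
    show "b \<in> Y" by (simp add: Y_def component_self)
    have "v4 \<notin> X" using refl by (simp add: X_def misses_def)
    then show "v4 \<in> V - Y" using YX V by blast
    show "\<not> A v4 z" if "z \<in> Y" for z using that YX sym[of v4 z] by (auto simp: X_def misses_def)
    show "A u v"
      if uv: "u \<in> V - Y" "v \<in> V - Y" "\<exists>z \<in> Y. A u z" "\<exists>z \<in> Y. A v z" for u v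
    proof (rule ccontr)
      assume n: "\<not> A u v"
      obtain k k' where k: "k \<in> component X b" "k' \<in> component X b" "A u k" "A k' v"
        using uv sym unfolding Y_def by blast
      note uS = S[OF uv(1,3)] and vS = S[OF uv(2,4)]
      have T: "?T z" if "z \<in> component X b" for z
        using that YX unfolding Y_def X_def by blast
      show False
      proof (rule connecting_path[OF bX k n])
        fix x
        assume "x \<in> component X b" "A u x" "A x v"
        then show False using hole5_edge_path1[OF h T uS vS _ _ n] by blast
      next
        fix x y
        assume "x \<in> component X b" "y \<in> component X b"
          "sees u [x]" "misses u [y, v]" "sees x [y]" "misses x [v]" "sees y [v]"
        then show False using hole5_edge_path2[OF h T T uS vS] by blast
      next
        fix x y z
        assume "x \<in> component X b" "y \<in> component X b" "z \<in> component X b"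
          "sees u [x]" "misses u [y, z, v]" "sees x [y]" "misses x [z, v]" "sees y [z]"
          "misses y [v]" "sees z [v]"
        then show False using hole5_edge_path3[OF h T T T uS vS] by blast
      qed
    qed
  qed
qed

lemma heavy_hole5_no_edge_type:
  assumes C: "heavy_hole5 v1 v2 v3 v4 v5" and "b \<in> V"
  shows "\<not> (sees b [v1, v2] \<and> misses b [v3, v4, v5])"
proof
  assume b: "sees b [v1, v2] \<and> misses b [v3, v4, v5]"
  have h: "hole5 v1 v2 v3 v4 v5" using C by (simp add: heavy_hole5_def)
  show False
    by (rule hole5_attached_to_edge[OF C _ _ _ _ assms(2)])
      (use hole5_edge_type_excludes[OF h b] b in \<open>auto simp: sees_def misses_def\<close>)
qed

text \<open>A vertex attached only to \<open>v1\<close> forces one attached only to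
  \<open>v5\<close>, as otherwise \<open>hole5_attached_to_edge\<close> applies. Repeating this
  yields one attached only to \<open>v4\<close>, which cannot coexist with the first.\<close>

lemma heavy_hole5_no_vertex_type:
  assumes C: "heavy_hole5 v1 v2 v3 v4 v5" and b: "b \<in> V"
  shows "\<not> (sees b [v1] \<and> misses b [v2, v3, v4, v5])"
proof
  assume t: "sees b [v1] \<and> misses b [v2, v3, v4, v5]"
  have h: "hole5 v1 v2 v3 v4 v5" using C by (simp add: heavy_hole5_def)
  have no_next: "\<exists>y \<in> V. sees y [v5] \<and> misses y [v1, v2, v3, v4]"
    if C: "heavy_hole5 v1 v2 v3 v4 v5" and b: "b \<in> V" "sees b [v1] \<and> misses b [v2, v3, v4, v5]"
    for v1 v2 v3 v4 v5 b
  proof (rule ccontr)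
    assume n: "\<not> ?thesis"
    have h: "hole5 v1 v2 v3 v4 v5" using C by (simp add: heavy_hole5_def)
    note r1 = heavy_hole5_rotate[OF C]
    note r4 = heavy_hole5_rotate[OF heavy_hole5_rotate[OF heavy_hole5_rotate[OF r1]]]
    show False
    proof (rule hole5_attached_to_edge[OF C _ _ _ _ b(1)])
      fix y assume y: "y \<in> V"
      show "\<not> (sees y [v3] \<and> misses y [v1, v2, v4, v5])"
        using hole5_vertex_type_excludes[OF h b(2)] by blast
      show "\<not> (sees y [v5] \<and> misses y [v1, v2, v3, v4])" using n y by blast
      show "\<not> (sees y [v2, v3] \<and> misses y [v1, v4, v5])"
        using heavy_hole5_no_edge_type[OF r1 y] by (auto simp: misses_def)
      show "\<not> (sees y [v1, v5] \<and> misses y [v2, v3, v4])"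
        using heavy_hole5_no_edge_type[OF r4 y] by (auto simp: sees_def)
    qed (use b(2) in \<open>auto simp: sees_def misses_def\<close>)
  qed
  obtain y where y: "y \<in> V" "sees y [v5] \<and> misses y [v1, v2, v3, v4]"
    using no_next[OF C b t] by blast
  note r4 = heavy_hole5_rotate[OF heavy_hole5_rotate[OF heavy_hole5_rotate[OF heavy_hole5_rotate[OF C]]]]
  have "\<exists>z \<in> V. sees z [v4] \<and> misses z [v5, v1, v2, v3]" by (rule no_next[OF r4 y])
  then show False
    using hole5_vertex_type_excludes[OF h t] by (auto simp: misses_def)
qed

section \<open>Rings of five cliques\<close>

definition ring_type :: "'a \<Rightarrow> 'a \<Rightarrow> 'a \<Rightarrow> 'a \<Rightarrow> 'a \<Rightarrow> 'a \<Rightarrow> bool" where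
  "ring_type v1 v2 v3 v4 v5 y \<longleftrightarrow>
    sees y [v1, v2, v5] \<and> misses y [v3, v4] \<or> sees y [v1, v2, v3] \<and> misses y [v4, v5] \<or>
    sees y [v2, v3, v4] \<and> misses y [v1, v5] \<or> sees y [v3, v4, v5] \<and> misses y [v1, v2] \<or>
    sees y [v1, v4, v5] \<and> misses y [v2, v3]"

lemma ring_type_rotate: "ring_type v1 v2 v3 v4 v5 y = ring_type v5 v1 v2 v3 v4 y"
  by (auto simp: ring_type_def sees_def misses_def)

text \<open>The excluded types leave three consecutive neighbours or all five. A vertex with all
  five sees every vertex of either kind, so it would be universal.\<close>

lemma heavy_hole5_ring:
  assumes C: "heavy_hole5 v1 v2 v3 v4 v5" and y: "y \<in> V"
  shows "ring_type v1 v2 v3 v4 v5 y"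
proof -
  have h: "hole5 v1 v2 v3 v4 v5" using C by (simp add: heavy_hole5_def)
  note r1 = heavy_hole5_rotate[OF C]
  note r2 = heavy_hole5_rotate[OF r1]
  note r3 = heavy_hole5_rotate[OF r2]
  note r4 = heavy_hole5_rotate[OF r3]
  have types: "ring_type v1 v2 v3 v4 v5 z \<or> sees z [v1, v2, v3, v4, v5]" if z: "z \<in> V" for z
    using hole5_types[OF h z] heavy_hole5_no_vertex_type[OF C z] heavy_hole5_no_vertex_type[OF r1 z]
      heavy_hole5_no_vertex_type[OF r2 z] heavy_hole5_no_vertex_type[OF r3 z]
      heavy_hole5_no_vertex_type[OF r4 z] heavy_hole5_no_edge_type[OF C z]
      heavy_hole5_no_edge_type[OF r1 z] heavy_hole5_no_edge_type[OF r2 z]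
      heavy_hole5_no_edge_type[OF r3 z] heavy_hole5_no_edge_type[OF r4 z]
    unfolding ring_type_def sees_def misses_def list.pred_inject simp_thms by argo
  have "A y z" if "sees y [v1, v2, v3, v4, v5]" "z \<in> V" for z
    using hole5_universal[OF h that(1)] types[OF that(2)] unfolding ring_type_def by blast
  then show ?thesis using types[OF y] no_universal_vertex[OF y] by blast
qed

text \<open>Vertices in the same bag have nested neighbourhoods.\<close>

lemma ring_exchange:
  assumes "hole5 v1 v2 v3 v4 v5" "sees u [v1, v2, v5] \<and> misses u [v3, v4]"
    "sees y [v1, v2, v5] \<and> misses y [v3, v4]"
    "sees p [v1, v2, v5] \<and> misses p [v3, v4] \<or> sees p [v1, v2, v3] \<and> misses p [v4,
      v5] \<or> sees p [v2, v3, v4] \<and> misses p [v1, v5] \<or> sees p [v3, v4, v5] \<and>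
      misses p [v1, v2] \<or> sees p [v1, v4, v5] \<and> misses p [v2, v3]"
    "sees q [v1, v2, v5] \<and> misses q [v3, v4] \<or> sees q [v1, v2, v3] \<and> misses q [v4,
      v5] \<or> sees q [v2, v3, v4] \<and> misses q [v1, v5] \<or> sees q [v3, v4, v5] \<and>
      misses q [v1, v2] \<or> sees q [v1, v4, v5] \<and> misses q [v2, v3]" "A p u" "\<not> A p y"
    "A q y" "\<not> A q u"
  shows "False"
  using assms no_hole4[of p u v2 v3] no_hole4[of p v5 y v2] no_hole4[of q v4 v5 y]
    no_hole4[of u v5 q v2] no_hole4[of v1 q v4 p] no_hole4[of v2 y q v3] no_hole4[of v3 q v1 p]
    no_hole4[of v5 v4 p u] no_hole4[of y u p q] no_hole4[of y v5 u v2] no_hole6[of u p v4 v3 q y]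
    no_hole6[of u y q v4 v3 p]
  by (simp_all (no_asm_use) only: finite_simps) satx?

lemma ring_same:
  assumes "hole5 v1 v2 v3 v4 v5" "sees y [v1, v2, v5] \<and> misses y [v3, v4]"
    "sees z [v1, v2, v5] \<and> misses z [v3, v4]"
  shows "A y z"
  using assms no_hole4[of v5 z v2 y]
  by (simp_all (no_asm_use) only: finite_simps) satx?

lemma ring_nb:
  assumes "hole5 v1 v2 v3 v4 v5" "sees u [v1, v2, v5] \<and> misses u [v3, v4]"
    "sees y [v1, v2, v5] \<and> misses y [v3, v4] \<or> sees y [v1, v2, v3] \<and> misses y [v4,
      v5] \<or> sees y [v2, v3, v4] \<and> misses y [v1, v5] \<or> sees y [v3, v4, v5] \<and>
      misses y [v1, v2] \<or> sees y [v1, v4, v5] \<and> misses y [v2, v3]" "A u y"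
  shows "sees y [v1, v2, v5] \<and> misses y [v3, v4] \<or> sees y [v1, v2, v3] \<and> misses y
    [v4, v5] \<or> sees y [v1, v4, v5] \<and> misses y [v2, v3]"
  using assms no_hole4[of v5 u y v4] no_hole4[of y u v2 v3]
  by (simp_all (no_asm_use) only: finite_simps) satx?

text \<open>Take \<open>u\<close> of minimum degree in the bag \<open>Q1\<close> of
  \<open>v1\<close>. By nestedness its neighbours see all of \<open>Q1\<close>, so \<open>Q1\<close>
  together with the neighbours of \<open>u\<close> in either adjacent bag is a clique. The two
  cliques cover \<open>nb u\<close> and overlap in \<open>Q1\<close>, which gives the first bound;
  replacing the second by the whole bag \<open>Q5\<close> gives the other.\<close>

lemma ring_bounds:
  assumes h: "hole5 v1 v2 v3 v4 v5" and ring: "\<And>y. y \<in> V \<Longrightarrow> ring_type v1 v2 v3 v4 v5 y"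
  defines "Q1 \<equiv> {y \<in> V. sees y [v1, v2, v5] \<and> misses y [v3, v4]}"
    and "Q5 \<equiv> {y \<in> V. sees y [v1, v4, v5] \<and> misses y [v2, v3]}"
  shows "\<exists>u \<in> V. card (nb u) + card Q1 \<le> 2 * w \<and> card (nb u) \<le> w + card Q5"
proof -
  have "v1 \<in> Q1"
    using hole5_in_V[OF h] h refl unfolding Q1_def by (simp_all only: finite_simps mem_Collect_eq) simp
  then obtain u where u: "u \<in> Q1" and min: "\<And>y. y \<in> Q1 \<Longrightarrow> card (nb u) \<le> card (nb y)"
    using ex_has_least_nat[of "\<lambda>y. y \<in> Q1" v1 "\<lambda>y. card (nb y)"] by blast
  let ?Q2 = "{y \<in> V. sees y [v1, v2, v3] \<and> misses y [v4, v5]}"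
  have uV: "u \<in> V" and ut: "sees u [v1, v2, v5] \<and> misses u [v3, v4]" using u by (simp_all add: Q1_def)
  define N where "N Q = {y \<in> Q. A y u}" for Q
  have same: "A y z" if "y \<in> Q1" "z \<in> Q1" for y z
    using ring_same[OF h] that unfolding Q1_def by blast
  have dom: "A p y" if p: "p \<in> V" "A p u" and y: "y \<in> Q1" for p y
  proof (rule ccontr)
    assume n: "\<not> A p y"
    obtain q where q: "q \<in> V" "A q y" "\<not> A q u"
      using nb_exchange[OF min[OF y] p n] by blast
    have "sees y [v1, v2, v5] \<and> misses y [v3, v4]" using y by (simp add: Q1_def)
    from ring_exchange[OF h ut this ring[OF p(1), unfolded ring_type_def]
        ring[OF q(1), unfolded ring_type_def] p(2) n q(2,3)]
    show False .
  qed
  have h2: "hole5 v2 v3 v4 v5 v1" and h5: "hole5 v5 v1 v2 v3 v4"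
    using h by (simp_all only: finite_simps)
  have clq2: "A y z" if "y \<in> ?Q2" "z \<in> ?Q2" for y z
    using ring_same[OF h2, of y z] that by (auto simp: sees_def misses_def)
  have clq5: "A y z" if "y \<in> Q5" "z \<in> Q5" for y z
    using ring_same[OF h5, of y z] that unfolding Q5_def by (auto simp: sees_def misses_def)
  have clique: "card (Q1 \<union> N Q) \<le> w"
    if "Q \<subseteq> V" "\<And>y z. y \<in> Q \<Longrightarrow> z \<in> Q \<Longrightarrow> A y z" for Q
  proof (rule card_clique)
    show "Q1 \<union> N Q \<subseteq> V" using that(1) by (auto simp: Q1_def N_def)
    have "A y z \<and> A z y" if "y \<in> N Q" "z \<in> Q1" for y z
      using dom[of y z] that \<open>Q \<subseteq> V\<close> sym[of z y] unfolding N_def by auto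
    then show "clq A (Q1 \<union> N Q)"
      using same that(2) unfolding clq_def N_def by blast
  qed
  have K2: "card (Q1 \<union> N ?Q2) \<le> w" by (rule clique) (use clq2 in auto)
  have K5: "card (Q1 \<union> N Q5) \<le> w" by (rule clique) (use clq5 in \<open>auto simp: Q5_def\<close>)
  have "nb u \<subseteq> Q1 \<union> N ?Q2 \<union> N Q5"
  proof
    fix y assume "y \<in> nb u"
    then have y: "y \<in> V" "A u y" by (simp_all add: nb_def)
    from ring_nb[OF h ut ring[OF y(1), unfolded ring_type_def] y(2)]
    show "y \<in> Q1 \<union> N ?Q2 \<union> N Q5" using y sym[of y u] by (auto simp: Q1_def Q5_def N_def)
  qed
  then have sub: "nb u \<subseteq> (Q1 \<union> N ?Q2) \<union> (Q1 \<union> N Q5)" "nb u \<subseteq> (Q1 \<union> N ?Q2) \<union> Q5"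
    by (auto simp: N_def)
  have fin': "finite (Q1 \<union> N ?Q2)" "finite (Q1 \<union> N Q5)" "finite Q5"
    using fin by (simp_all add: Q1_def Q5_def N_def)
  have "card (nb u) + card Q1 \<le> card (Q1 \<union> N ?Q2 \<union> (Q1 \<union> N Q5)) + card ((Q1 \<union> N ?Q2) \<inter> (Q1 \<union> N Q5))"
    using fin' sub(1) by (intro add_mono card_mono) auto
  also have "\<dots> = card (Q1 \<union> N ?Q2) + card (Q1 \<union> N Q5)"
    using card_Un_Int[OF fin'(1,2)] by simp
  finally have "card (nb u) + card Q1 \<le> 2 * w" using K2 K5 by simp
  moreover have "card (nb u) \<le> card ((Q1 \<union> N ?Q2) \<union> Q5)"
    using fin' sub(2) by (intro card_mono) auto
  then have "card (nb u) \<le> w + card Q5"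
    using card_Un_le[of "Q1 \<union> N ?Q2" Q5] K2 by simp
  ultimately show ?thesis using uV by blast
qed

text \<open>The second bound at \<open>v1\<close> and the first at \<open>v5\<close> involve the
  same bag, that of \<open>v5\<close>. Its size cancels in the sum: two closed neighbourhoods have
  together at most \<open>3 * w\<close> elements.\<close>

lemma no_hole5: "\<not> hole5 a1 a2 a3 a4 a5"
proof
  assume "hole5 a1 a2 a3 a4 a5"
  then obtain v1 v2 v3 v4 v5 where C: "heavy_hole5 v1 v2 v3 v4 v5"
    using heavy_hole5_exists by blast
  have h: "hole5 v1 v2 v3 v4 v5" using C by (simp add: heavy_hole5_def)
  have h': "hole5 v5 v1 v2 v3 v4" using h by (simp only: finite_simps)
  note ring = heavy_hole5_ring[OF C]
  obtain u where u: "u \<in> V" "card (nb u) \<le> w + card {y \<in> V. sees y [v1, v4, v5] \<and> misses y [v2, v3]}"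
    using ring_bounds[OF h ring] by blast
  obtain u' where u': "u' \<in> V"
      "card (nb u') + card {y \<in> V. sees y [v5, v1, v4] \<and> misses y [v2, v3]} \<le> 2 * w"
    using ring_bounds[OF h'] ring ring_type_rotate by blast
  have "{y \<in> V. sees y [v5, v1, v4] \<and> misses y [v2, v3]} = {y \<in> V. sees y [v1, v4, v5] \<and> misses y [v2, v3]}"
    by (auto simp: sees_def)
  then show False using u u' card_nb[of u] card_nb[of u'] by simp
qed

text \<open>All attachments of a component of the nonneighbours of \<open>x\<close> see
  \<open>x\<close>. If two of them are nonadjacent, a shortest path between them closes with
  \<open>x\<close> to a hole of length four, five or six, all excluded; otherwise they form a clique
  cutset.\<close>

lemma contradiction: False
proof -
  have "V \<noteq> {}" using not_colourable by (auto simp: colourable_def)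
  then obtain x where x: "x \<in> V" by blast
  then obtain y where y: "y \<in> V" "\<not> A x y" using no_universal_vertex by blast
  define X where "X = {z \<in> V. \<not> A x z}"
  have yX: "y \<in> X" using y by (simp add: X_def)
  define K where "K = component X y"
  have K: "K \<subseteq> X" using component_subset[OF yX] by (simp add: K_def)
  have out: "A x u" if "u \<in> V - K" "\<exists>z \<in> K. A u z" for u
    using that component_closed[OF yX] sym unfolding X_def K_def by blast
  show False
  proof (rule no_clique_cutset[of K y x])
    show "K \<subseteq> V" using K by (auto simp: X_def)
    show "y \<in> K" by (simp add: K_def component_self)
    show "x \<in> V - K" using K x refl by (auto simp: X_def)
    show "\<not> A x z" if "z \<in> K" for z using that K by (auto simp: X_def)
    show "A u v"
      if uv: "u \<in> V - K" "v \<in> V - K" "\<exists>z \<in> K. A u z" "\<exists>z \<in> K. A v z" for u v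
    proof (rule ccontr)
      assume n: "\<not> A u v"
      obtain k k' where k: "k \<in> component X y" "k' \<in> component X y" "A u k" "A k' v"
        using uv sym unfolding K_def by blast
      have xu: "sees x [u, v]" using out uv by (simp add: sees_def)
      have X: "misses x [z]" if "z \<in> component X y" for z
        using that K unfolding K_def X_def by (auto simp: misses_def)
      show False
      proof (rule connecting_path[OF yX k n])
        fix a
        assume "a \<in> component X y" "A u a" "A a v"
        then have "hole4 x u a v" using xu X[of a] n by (simp only: finite_simps)
        then show False using no_hole4 by blast
      next
        fix a b
        assume "a \<in> component X y" "b \<in> component X y"
          "sees u [a]" "misses u [b, v]" "sees a [b]" "misses a [v]" "sees b [v]"
        then have "hole5 x u a b v" using xu X[of a] X[of b] by (simp only: finite_simps)
        then show False using no_hole5 by blast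
      next
        fix a b c
        assume "a \<in> component X y" "b \<in> component X y" "c \<in> component X y"
          "sees u [a]" "misses u [b, c, v]" "sees a [b]" "misses a [c, v]" "sees b [c]"
          "misses b [v]" "sees c [v]"
        then have "hole6 x u a b c v" using xu X[of a] X[of b] X[of c] by (simp only: finite_simps)
        then show False using no_hole6 by blast
      qed
    qed
  qed
qed

end

section \<open>The colouring bound\<close>

text \<open>Equality is kept on the whole type because the locale asks for reflexivity everywhere,
  while adjacency of distinct vertices must stay inside \<open>W\<close>.\<close>

definition restrict :: "('a \<Rightarrow> 'a \<Rightarrow> bool) \<Rightarrow> 'a set \<Rightarrow> 'a \<Rightarrow> 'a \<Rightarrow> bool" where
  "restrict A W x y \<longleftrightarrow> x = y \<or> x \<in> W \<and> y \<in> W \<and> A x y"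

lemma P6_C4_free_restrict:
  assumes "P6_C4_free V A" "W \<subseteq> V"
  shows "P6_C4_free W (restrict A W)"
proof -
  interpret G: P6_C4_free V A by fact
  interpret R: closed_adjacency W "restrict A W"
    by unfold_locales (use assms(2) G.fin G.sym finite_subset in \<open>auto simp: restrict_def\<close>)
  have eq: "restrict A W x y = A x y" if "x \<in> W" "y \<in> W" for x y
    using that G.refl by (auto simp: restrict_def)
  show ?thesis
  proof unfold_locales
    fix a b c d e f
    show "\<not> R.path6 a b c d e f"
    proof
      assume p: "R.path6 a b c d e f"
      then have "a \<in> W" "b \<in> W" "c \<in> W" "d \<in> W" "e \<in> W" "f \<in> W"
        using R.in_V2[of b a c] R.in_V2[of c b d] R.in_V2[of d c e] R.in_V2[of e d f]
          R.in_V2[of e f d] by (simp_all only: R.finite_simps)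
      then have "G.path6 a b c d e f"
        using p eq by (simp add: R.path6_def G.path6_def R.sees_def G.sees_def R.misses_def G.misses_def)
      then show False using G.no_path6 by blast
    qed
    show "\<not> R.hole4 a b c d"
    proof
      assume p: "R.hole4 a b c d"
      then have "a \<in> W" "b \<in> W" "c \<in> W" "d \<in> W"
        using R.in_V2[of a b d] R.in_V2[of c b d] R.in_V2[of d a c] by (simp_all only: R.finite_simps)
      then have "G.hole4 a b c d"
        using p eq by (simp add: R.hole4_def G.hole4_def R.sees_def G.sees_def R.misses_def G.misses_def)
      then show False using G.no_hole4 by blast
    qed
  qed
qed

text \<open>The induction generalises over \<open>A\<close> too, since a proper subset is treated
  with its restricted adjacency.\<close>

lemma P6_C4_free_colourable:
  "P6_C4_free V A \<Longrightarrow> clique_bound A V m \<Longrightarrow> colourable A V (3 * m div 2)"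
proof (induction "card V" arbitrary: V A m rule: less_induct)
  case less
  show ?case
  proof (rule ccontr)
    assume n: "\<not> colourable A V (3 * m div 2)"
    interpret P6_C4_free V A by (rule less.prems(1))
    have "colourable A W (3 * k div 2)" if W: "W \<subset> V" "clique_bound A W k" for W k
    proof -
      have "clq A K" if "clq (restrict A W) K" for K
        using that refl unfolding clq_def restrict_def by metis
      then have "clique_bound (restrict A W) W k"
        using W(2) unfolding clique_bound_def by blast
      moreover have "P6_C4_free W (restrict A W)"
        using P6_C4_free_restrict[OF less.prems(1)] W(1) by blast
      moreover have "card W < card V" using W(1) fin by (rule psubset_card_mono[rotated])
      ultimately have "colourable (restrict A W) W (3 * k div 2)" using less.hyps by blast
      then show ?thesis unfolding colourable_def restrict_def by blast
    qed
    then interpret minimal_counterexample V A m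
      by unfold_locales (use n less.prems(2) in auto)
    show False by (rule contradiction)
  qed
qed

section \<open>From the graph library to closed adjacency\<close>

lemma lessThan_6: "{..<6::nat} = {0, 1, 2, 3, 4, 5}"
  by auto

lemma lessThan_4: "{..<4::nat} = {0, 1, 2, 3}"
  by auto

lemma P6_C4_free_pair_graph:
  assumes G: "pair_graph G"
    and P: "\<not> contains_induced G (path_graph 6)" and C: "\<not> contains_induced G (cycle_graph 4)"
  shows "P6_C4_free (pverts G) (\<lambda>x y. x = y \<or> (x, y) \<in> parcs G)"
proof -
  interpret G: pair_graph G by fact
  let ?A = "\<lambda>x y. x = y \<or> (x, y) \<in> parcs G"
  have sym: "(x, y) \<in> parcs G \<longleftrightarrow> (y, x) \<in> parcs G" for x y
    using G.arcs_symmetric by blast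
  have loop: "(x, x) \<notin> parcs G" for x
    using G.pair_no_loops[of "(x, x)"] by auto
  interpret R: closed_adjacency "pverts G" ?A
    by unfold_locales (use sym G.in_arcsD1 in auto)
  have V: "x \<in> pverts G \<and> y \<in> pverts G" if "(x, y) \<in> parcs G" for x y
    using that G.in_arcsD1 G.in_arcsD2 by blast
  show ?thesis
  proof unfold_locales
    fix a b c d e f
    show "\<not> R.path6 a b c d e f"
    proof
      assume "R.path6 a b c d e f"
      then have p: "?A a b" "?A b c" "?A c d" "?A d e" "?A e f" "\<not> ?A a c" "\<not> ?A a d" "\<not> ?A a e"
        "\<not> ?A a f" "\<not> ?A b d" "\<not> ?A b e" "\<not> ?A b f" "\<not> ?A c e" "\<not> ?A c f" "\<not> ?A d f"
        by (simp_all add: R.path6_def R.sees_def R.misses_def)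
      then have ne: "a \<noteq> b" "b \<noteq> c" "c \<noteq> d" "d \<noteq> e" "e \<noteq> f" by metis+
      define h where "h i = [a, b, c, d, e, f] ! i" for i :: nat
      have h: "h 0 = a" "h 1 = b" "h 2 = c" "h 3 = d" "h 4 = e" "h 5 = f"
        by (simp_all add: h_def)
      have "inj_on h (pverts (path_graph 6))"
        using p ne h by (auto simp: path_graph_def lessThan_6 inj_on_def)
      moreover have "h ` pverts (path_graph 6) \<subseteq> pverts G"
        using p ne h V by (auto simp: path_graph_def lessThan_6)
      moreover have "\<forall>u \<in> pverts (path_graph 6). \<forall>v \<in> pverts (path_graph 6).
          (u, v) \<in> parcs (path_graph 6) \<longleftrightarrow> (h u, h v) \<in> parcs G"
        using p ne h by (auto simp: path_graph_def lessThan_6 loop sym)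
      ultimately show False
        using P unfolding contains_induced_iff_embedding[OF G pair_graph_path_graph] by blast
    qed
    show "\<not> R.hole4 a b c d"
    proof
      assume "R.hole4 a b c d"
      then have p: "?A a b" "?A b c" "?A c d" "?A a d" "\<not> ?A a c" "\<not> ?A b d"
        by (simp_all add: R.hole4_def R.sees_def R.misses_def)
      then have ne: "a \<noteq> b" "b \<noteq> c" "c \<noteq> d" "a \<noteq> d" using sym by metis+
      have c4: "pair_graph (cycle_graph 4)" by (rule pair_graph_cycle_graph) simp
      define h where "h i = [a, b, c, d] ! i" for i :: nat
      have h: "h 0 = a" "h 1 = b" "h 2 = c" "h 3 = d" by (simp_all add: h_def)
      have pv: "pverts (cycle_graph 4) = {0, 1, 2, 3}"
        by (simp add: cycle_graph_def lessThan_4)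
      have "inj_on h (pverts (cycle_graph 4))"
        using p ne h by (auto simp: pv inj_on_def)
      moreover have "h ` pverts (cycle_graph 4) \<subseteq> pverts G"
        using p ne h V by (auto simp: pv)
      moreover have "\<forall>u \<in> pverts (cycle_graph 4). \<forall>v \<in> pverts (cycle_graph 4).
          (u, v) \<in> parcs (cycle_graph 4) \<longleftrightarrow> (h u, h v) \<in> parcs G"
        using p ne h by (auto simp: pv parcs_cycle_graph_4 loop sym)
      ultimately show False
        using C unfolding contains_induced_iff_embedding[OF G c4] by blast
    qed
  qed
qed

theorem theorem2:
  fixes G :: "'a pair_pre_digraph"
  assumes "pair_graph G"
    and "\<not> contains_induced G (path_graph 6)"
    and "\<not> contains_induced G (cycle_graph 4)"
  shows "real (chromatic_number G) \<le> 3 / 2 * real (clique_number G)"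
proof -
  let ?A = "\<lambda>x y. x = y \<or> (x, y) \<in> parcs G"
  interpret pair_graph G by fact
  have "is_clique G K" if "K \<subseteq> pverts G" "clq ?A K" for K
    using that unfolding is_clique_def clq_def pairwise_def by blast
  then have "clique_bound ?A (pverts G) (clique_number G)"
    using card_clique_le[OF assms(1)] unfolding clique_bound_def by blast
  then have "colourable ?A (pverts G) (3 * clique_number G div 2)"
    by (rule P6_C4_free_colourable[OF P6_C4_free_pair_graph[OF assms]])
  then obtain c where c: "\<forall>x \<in> pverts G. c x < 3 * clique_number G div 2"
      "\<forall>x \<in> pverts G. \<forall>y \<in> pverts G. x \<noteq> y \<longrightarrow> ?A x y \<longrightarrow> c x \<noteq> c y"
    unfolding colourable_def by blast
  have "c u \<noteq> c v" if "(u, v) \<in> parcs G" for u v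
    using c(2) that in_arcsD1[OF that] in_arcsD2[OF that] pair_no_loops[OF that] by auto
  then have "proper_colouring G (3 * clique_number G div 2) c"
    using c(1) by (auto simp: proper_colouring_def)
  then have "chromatic_number G \<le> 3 * clique_number G div 2"
    unfolding chromatic_number_def by (intro Least_le) blast
  then show ?thesis by linarith
qed

end
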